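(* Let $\tau$ be an element of $\mathbb{H}_{d,\alpha}$. The subset $\mathrm{M}_{1,2d}(\mathbb{Z})\backslash\mathrm{M}_{1,2d}(\mathbb{R})\cdot 1$ of $P_\alpha^u(\mathbb{Z})\backslash P_\alpha^u(\mathbb{R})U(\mathbb{C})$ corresponds, under the bijection $P_\alpha^u(\mathbb{R})U(\mathbb{C})\to D_{\alpha,\tau}$, $p\mapsto p\cdot\tilde\tau$, to the unit section over $B_\tau$ of the Poincaré torsor $P_\alpha^u(\mathbb{Z})\backslash D_{\alpha,\tau}$ on $A_\tau\times B_\tau$. For $x$ in $\mathrm{M}_{1,2d}(\mathbb{R})$ and $\overline{x}$ its image in $B_\tau$, the extension $E_{\tau,\overline{x}}$ of $A_\tau$ by $\mathbb{C}^\times$ corresponding to $\overline{x}$ is, as real Lie group, $(\mathbb{C}/2\pi i\mathbb{Z})\times(\mathrm{M}_{2d,1}(\mathbb{R})/\mathrm{M}_{2d,1}(\mathbb{Z}))$, and $r_f(\overline{x})$ is given by $(2\pi i\,xf_{\mathbb{Z}}x^t,\ \alpha_{\mathbb{Z}}x^t)$. If $\overline{x}$ is of order $n$ in $B_\tau$, then $r_f(\overline{x})$ in $E_{\tau,\overline{x}}$ is killed by $n^2$.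
   Context: Matrices and Siegel space. $\mathrm{M}_{m,n}(R)$ denotes $m\times n$ matrices over $R$; $d\ge1$; $\mathbb{H}_d$ is the set of symmetric $\tau\in\mathrm{M}_d(\mathbb{C})$ with $\mathrm{Im}(\tau)$ positive definite. $\mathbb{Z}(1)=2\pi i\mathbb{Z}$, of Hodge type $(-1,-1)$. $\Psi(x,y)=2\pi i\,x^t\begin{pmatrix}0&-1_d\\1_d&0\end{pmatrix}y$ on $\mathbb{Z}^{2d}$. $\mathrm{GSp}(\Psi)(R)$ is the group of pairs $(g,\mu(g))\in\mathrm{GL}_{2d}(R)\times R^\times$ with $\Psi(gx,gy)=\mu(g)\Psi(x,y)$. The set $D$. $M=\mathbb{Z}(1)\oplus\mathbb{Z}^{2d}\oplus\mathbb{Z}$ with $\mathbb{Z}$-basis $2\pi i e_0,e_1,\dots,e_{2d+1}$ and weight filtration $W_{-3}M=0$, $W_{-2}M=\mathbb{Z}\cdot 2\pi i e_0$, $W_{-1}M=\mathbb{Z}(1)\oplus\mathbb{Z}^{2d}$, $W_0M=M$. $D$ is the set of filtrations $F$ on $M_{\mathbb{C}}$ such that $(M,W,F)$ is a mixed $\mathbb{Z}$-Hodge structure of type $\{(-1,-1),(-1,0),(0,-1),(0,0)\}$ and $\Psi$ is a polarisation on $\mathrm{Gr}^W_{-1}M=\mathbb{Z}^{2d}$. Such $F$ is given by $F^0$, and $D$ is in bijection with $\mathbb{H}_d\times\mathrm{M}_{1,d}(\mathbb{C})\times\mathrm{M}_{d,1}(\mathbb{C})\times\mathbb{C}$ via $(\tau,u,v,w)\mapsto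 F^0=\begin{pmatrix}u&w\\ \tau&v\\1_d&0\\0&1\end{pmatrix}\mathbb{C}^{d+1}\subset M_{\mathbb{C}}=\bigoplus_j\mathbb{C}e_j$. Write $\tilde\tau$ for the point $(\tau,0,0,0)$. Groups. With respect to the basis $2\pi i e_0,e_1,\dots,e_{2d+1}$, $P(R)$ is the group of matrices $\begin{pmatrix}\mu(g)&x&z\\0&g&y\\0&0&1\end{pmatrix}$ with $(g,\mu(g))\in\mathrm{GSp}(\Psi)(R)$, $x\in\mathrm{M}_{1,2d}(R)$, $y\in\mathrm{M}_{2d,1}(R)$, $z\in R$; $P^u$ is the subgroup with $g=1$, $\mu(g)=1$ and $U\subset P^u$ the subgroup with moreover $x=0$, $y=0$. In $P^u(R)$, $\mathrm{M}_{1,2d}(R)$ denotes the subgroup with $y=0$, $z=0$. $P(\mathbb{R})^+U(\mathbb{C})$ acts on $D$ by acting on $F^0\subset M_{\mathbb{C}}$. Abelian varieties. $A_\tau=\mathrm{M}_{d,1}(\mathbb{C})/(1_d\ \,-\tau)\mathrm{M}_{2d,1}(\mathbb{Z})$ and $B_\tau=\mathrm{M}_{1,d}(\mathbb{C})/\mathrm{M}_{1,2d}(\mathbb{Z}(1))\begin{pmatrix}\tau\\1_d\end{pmatrix}$. $P^u(\mathbb{Z})\backslash D$ is the universal Poincaré torsor over $\mathbb{H}_d$: its fibre at $\tau$ is the Poincaré $\mathbb{C}^\times$-torsor $\mathcal{P}_\tau$ on $A_\tau\times B_\tau$ ($v$ gives the point of $A_\tau$, $u$ the point of $B_\tau$),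 which identifies $B_\tau$ with $A_\tau^\vee$ and $A_\tau$ with $B_\tau^\vee$; over $B_\tau$ it is the universal extension of $A_\tau$ by $\mathbb{C}^\times$. The data $f,\alpha$. Fix $\tau_0\in\mathbb{H}_d$ and a morphism $f\colon B_{\tau_0}\to A_{\tau_0}$, with dual $f^\vee\colon B_{\tau_0}\to A_{\tau_0}$, and $\alpha=f-f^\vee$. Let $f_{\mathbb{Z}}\in\mathrm{M}_{2d}(\mathbb{Z})$ be the matrix such that $f$ on lattices is $\mathrm{M}_{1,2d}(\mathbb{Z}(1))\to\mathrm{M}_{2d,1}(\mathbb{Z})$, $2\pi i\,n\mapsto f_{\mathbb{Z}}n^t$; likewise $\alpha$ is given by $2\pi i\,n\mapsto\alpha_{\mathbb{Z}}n^t$, and $\alpha_{\mathbb{Z}}=f_{\mathbb{Z}}+f_{\mathbb{Z}}^t$. View this last map as a map $\mathrm{Gr}^W_{-1}(M)^\vee(1)\to\mathrm{Gr}^W_{-1}(M)$ ( * ). $P_\alpha$ and $G_\alpha$ are the identity components of the stabilisers of ( * ) in $P$ and in $\mathrm{GSp}(\Psi)$; $P_\alpha$ is the inverse image of $G_\alpha$ in $P$, and $P_\alpha^u=P^u$. Put $D_\alpha=P_\alpha(\mathbb{R})^+U(\mathbb{C})\cdot\tilde\tau_0\subset D$ and $\mathbb{H}_{d,\alpha}=G_\alpha(\mathbb{R})^+\cdot\tau_0\subset\mathbb{H}_d$; $D_{\alpha,\tau}$ is the fibre of $D_\alpha\to\mathbb{H}_{d,\alpha}$ at $\tau$. For every $\tau\in\mathbb{H}_{d,\alpha}$,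 $\alpha_{\mathbb{Z}}$ induces a morphism $\alpha\colon B_\tau\to A_\tau$, and $P_\alpha^u(\mathbb{Z})\backslash D_{\alpha,\tau}=\mathcal{P}_\tau$. The Ribet section $r_f$ over $B_\tau$ is the unique section, with value $1$ at the origin, of the restriction of $\mathcal{P}_\tau$ to the graph of $\alpha\colon B_\tau\to A_\tau$. Coordinates. The image $\overline{x}\in B_\tau$ of $x=(x_1,x_2)\in\mathrm{M}_{1,2d}(\mathbb{R})$ is the class of $2\pi i(x_1\tau+x_2)$. In the description of $E_{\tau,\overline{x}}$, the pair $(2\pi i z,y)$ with $z\in\mathbb{C}$, $y\in\mathrm{M}_{2d,1}(\mathbb{R})$ corresponds to the class of $p_{z,y}\cdot p_x\cdot\tilde\tau$, where, in the basis $2\pi i e_0,e_1,\dots,e_{2d+1}$, $p_x=\begin{pmatrix}1&x&0\\0&1&0\\0&0&1\end{pmatrix}$ and $p_{z,y}=\begin{pmatrix}1&0&z\\0&1&y\\0&0&1\end{pmatrix}$. *)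

theory Defs
  imports "HOL-Analysis.Analysis" "HOL-Algebra.Algebra"
begin

section \<open>Vectors and matrices\<close>

text \<open>
  The dimension \<open>d \<ge> 1\<close> is the cardinality of the index type \<open>'d\<close>; a vector of length \<open>2d\<close> is
  indexed by \<open>'d + 'd\<close>. Row vectors and column vectors are both elements of \<open>'a ^ 'n\<close>; a row
  vector multiplies a matrix from the left by \<open>v*\<close>. The group of \<open>R\<close>-points, for
  \<open>R\<close> one of the rings of integers, real and complex numbers, is formed by complex matrices with
  entries in the corresponding subset of the complex numbers.
\<close>

definition upper :: "'a ^ ('d::finite + 'd) \<Rightarrow> 'a ^ 'd" where
  "upper x = (\<chi> i. x $ Inl i)"

definition lower :: "'a ^ ('d::finite + 'd) \<Rightarrow> 'a ^ 'd" where
  "lower x = (\<chi> i. x $ Inr i)"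

definition stack :: "'a ^ 'd::finite \<Rightarrow> 'a ^ 'd \<Rightarrow> 'a ^ ('d + 'd)" where
  "stack a b = (\<chi> i. case i of Inl k \<Rightarrow> a $ k | Inr k \<Rightarrow> b $ k)"

definition vecs :: "'a set \<Rightarrow> ('a ^ 'n::finite) set" where
  "vecs R = {x. \<forall>i. x $ i \<in> R}"

definition mats :: "'a set \<Rightarrow> ('a ^ 'n::finite ^ 'n) set" where
  "mats R = {A. \<forall>i j. A $ i $ j \<in> R}"

definition cvec :: "real ^ 'n::finite \<Rightarrow> complex ^ 'n" where
  "cvec x = (\<chi> i. complex_of_real (x $ i))"

definition dotc :: "complex ^ 'n::finite \<Rightarrow> complex ^ 'n \<Rightarrow> complex" where
  "dotc x y = (\<Sum>i\<in>UNIV. x $ i * y $ i)"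

abbreviation two_pi_i :: complex where
  "two_pi_i \<equiv> 2 * complex_of_real pi * \<i>"

definition vec_group :: "('a::ab_group_add) monoid" where
  "vec_group = \<lparr>carrier = UNIV, mult = (+), one = 0\<rparr>"

definition mat_monoid :: "(complex ^ 'n::finite ^ 'n) set \<Rightarrow> (complex ^ 'n ^ 'n) monoid" where
  "mat_monoid S = \<lparr>carrier = S, mult = (**), one = mat 1\<rparr>"


section \<open>The Siegel space and the groups\<close>

definition siegel :: "(complex ^ 'd::finite ^ 'd) set" where
  "siegel = {\<tau>. transpose \<tau> = \<tau> \<and>
     (\<forall>v :: real ^ 'd. v \<noteq> 0 \<longrightarrow> 0 < v \<bullet> (map_matrix Im \<tau> *v v))}"

definition Jmat :: "complex ^ ('d::finite + 'd) ^ ('d + 'd)" where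
  "Jmat = (\<chi> i j. case i of
      Inl a \<Rightarrow> (case j of Inl b \<Rightarrow> 0 | Inr b \<Rightarrow> if a = b then -1 else 0)
    | Inr a \<Rightarrow> (case j of Inl b \<Rightarrow> if a = b then 1 else 0 | Inr b \<Rightarrow> 0))"

definition Psi :: "complex ^ ('d::finite + 'd) \<Rightarrow> complex ^ ('d + 'd) \<Rightarrow> complex" where
  "Psi x y = two_pi_i * dotc x (Jmat *v y)"

definition GSp :: "complex set \<Rightarrow> ((complex ^ ('d::finite + 'd) ^ ('d + 'd)) \<times> complex) set" where
  "GSp R = {(g, \<mu>). g \<in> mats R \<and> det g \<noteq> 0 \<and> inverse (det g) \<in> R \<and>
     \<mu> \<in> R \<and> \<mu> \<noteq> 0 \<and> inverse \<mu> \<in> R \<and>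
     (\<forall>x\<in>vecs R. \<forall>y\<in>vecs R. Psi (g *v x) (g *v y) = \<mu> * Psi x y)}"

text \<open>Indices \<open>0\<close>, \<open>1, \<dots>, 2d\<close> and \<open>2d + 1\<close> of the basis of \<open>M\<close>.\<close>

type_synonym 'd midx = "unit + ('d + 'd) + unit"

definition block ::
  "complex \<Rightarrow> complex ^ ('d::finite + 'd) ^ ('d + 'd) \<Rightarrow> complex ^ ('d + 'd) \<Rightarrow> complex ^ ('d + 'd)
   \<Rightarrow> complex \<Rightarrow> complex ^ 'd midx ^ 'd midx" where
  "block \<mu> g x y z = (\<chi> i j. case i of
      Inl _ \<Rightarrow> (case j of Inl _ \<Rightarrow> \<mu> | Inr (Inl b) \<Rightarrow> x $ b | Inr (Inr _) \<Rightarrow> z)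
    | Inr (Inl a) \<Rightarrow> (case j of Inl _ \<Rightarrow> 0 | Inr (Inl b) \<Rightarrow> g $ a $ b | Inr (Inr _) \<Rightarrow> y $ a)
    | Inr (Inr _) \<Rightarrow> (case j of Inl _ \<Rightarrow> 0 | Inr (Inl b) \<Rightarrow> 0 | Inr (Inr _) \<Rightarrow> 1))"

definition Pu :: "complex set \<Rightarrow> (complex ^ 'd::finite midx ^ 'd midx) set" where
  "Pu R = {block 1 (mat 1) x y z | x y z. x \<in> vecs R \<and> y \<in> vecs R \<and> z \<in> R}"

definition Ugrp :: "complex set \<Rightarrow> (complex ^ 'd::finite midx ^ 'd midx) set" where
  "Ugrp R = {block 1 (mat 1) 0 0 z | z. z \<in> R}"

definition PuR_UC :: "(complex ^ 'd::finite midx ^ 'd midx) set" where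
  "PuR_UC = Pu \<real> <#>\<^bsub>mat_monoid UNIV\<^esub> Ugrp UNIV"

text \<open>
  For an integral matrix \<open>N\<close>, the map \<open>n \<mapsto> N n\<^sup>t\<close> from the twisted dual of the graded piece of
  weight \<open>-1\<close> to that graded piece. A pair \<open>(g, \<mu>)\<close> acts on the source, whose elements are row
  vectors, by \<open>n \<mapsto> \<mu> n g\<^sup>-\<^sup>1\<close> (dual, twisted by the action \<open>\<mu>\<close> on \<open>\<int>(1)\<close>), and on
  the target by \<open>g\<close>. Its stabiliser consists of the elements for which it is equivariant.
\<close>

definition stab_GSp ::
  "int ^ ('d::finite + 'd) ^ ('d + 'd) \<Rightarrow> complex set
   \<Rightarrow> ((complex ^ ('d + 'd) ^ ('d + 'd)) \<times> complex) set" where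
  "stab_GSp N R = {(g, \<mu>) \<in> GSp R. \<forall>n\<in>vecs R.
     g *v (map_matrix of_int N *v n) = map_matrix of_int N *v (\<mu> *s (n v* matrix_inv g))}"

definition stab_P ::
  "int ^ ('d::finite + 'd) ^ ('d + 'd) \<Rightarrow> complex set \<Rightarrow> (complex ^ 'd midx ^ 'd midx) set" where
  "stab_P N R = {block \<mu> g x y z | \<mu> g x y z.
     (g, \<mu>) \<in> stab_GSp N R \<and> x \<in> vecs R \<and> y \<in> vecs R \<and> z \<in> R}"

text \<open>
  The identity component of an algebraic group over a subfield of the complex numbers is
  geometrically connected, and its complex points are the identity component of the complex points
  of the group for the usual topology. The real points below are those elements of this component
  whose entries are real, and \<open>_Rplus\<close> is the identity component of the latter
  for the usual topology.
\<close>

definition G_alpha ::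
  "int ^ ('d::finite + 'd) ^ ('d + 'd) \<Rightarrow> ((complex ^ ('d + 'd) ^ ('d + 'd)) \<times> complex) set" where
  "G_alpha N = connected_component_set (stab_GSp N UNIV) (mat 1, 1)"

definition G_alpha_Rplus ::
  "int ^ ('d::finite + 'd) ^ ('d + 'd) \<Rightarrow> ((complex ^ ('d + 'd) ^ ('d + 'd)) \<times> complex) set" where
  "G_alpha_Rplus N = connected_component_set (G_alpha N \<inter> mats \<real> \<times> \<real>) (mat 1, 1)"

definition P_alpha ::
  "int ^ ('d::finite + 'd) ^ ('d + 'd) \<Rightarrow> (complex ^ 'd midx ^ 'd midx) set" where
  "P_alpha N = connected_component_set (stab_P N UNIV) (mat 1)"

definition P_alpha_Rplus ::
  "int ^ ('d::finite + 'd) ^ ('d + 'd) \<Rightarrow> (complex ^ 'd midx ^ 'd midx) set" where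
  "P_alpha_Rplus N = connected_component_set (P_alpha N \<inter> mats \<real>) (mat 1)"


section \<open>The period space\<close>

definition col ::
  "complex \<Rightarrow> complex ^ ('d::finite + 'd) \<Rightarrow> complex \<Rightarrow> complex ^ 'd midx" where
  "col a m b = (\<chi> i. case i of Inl _ \<Rightarrow> a | Inr (Inl k) \<Rightarrow> m $ k | Inr (Inr _) \<Rightarrow> b)"

text \<open>
  The subspace \<open>F\<^sup>0\<close> of \<open>M\<^sub>\<complex>\<close> with parameters \<open>(\<tau>, u, v, w)\<close>, in coordinates with respect
  to \<open>e\<^sub>0, \<dots>\<close> (not \<open>2\<pi>i e\<^sub>0, \<dots>\<close>).
\<close>

definition F0 ::
  "complex ^ 'd::finite ^ 'd \<Rightarrow> complex ^ 'd \<Rightarrow> complex ^ 'd \<Rightarrow> complex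
   \<Rightarrow> (complex ^ 'd midx) set" where
  "F0 \<tau> u v w = {col (dotc u c + w * t) (stack (\<tau> *v c + t *s v) c) t | c t. True}"

definition tilde :: "complex ^ 'd::finite ^ 'd \<Rightarrow> (complex ^ 'd midx) set" where
  "tilde \<tau> = F0 \<tau> 0 0 0"

definition scale0 :: "complex \<Rightarrow> complex ^ 'd::finite midx \<Rightarrow> complex ^ 'd midx" where
  "scale0 a m = (\<chi> i. case i of Inl _ \<Rightarrow> a * m $ i | Inr _ \<Rightarrow> m $ i)"

text \<open>
  Matrices are taken with respect to the basis \<open>2\<pi>i e\<^sub>0, e\<^sub>1, \<dots>\<close>, whence the change of coordinates.
\<close>

definition act ::
  "complex ^ 'd::finite midx ^ 'd midx \<Rightarrow> (complex ^ 'd midx) set \<Rightarrow> (complex ^ 'd midx) set" where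
  "act p F = (\<lambda>m. scale0 two_pi_i (p *v scale0 (1 / two_pi_i) m)) ` F"

text \<open>The fibre at \<open>\<tau>\<close> of the full period space over the Siegel space.\<close>

definition D_fibre :: "complex ^ 'd::finite ^ 'd \<Rightarrow> (complex ^ 'd midx) set set" where
  "D_fibre \<tau> = {F0 \<tau> u v w | u v w. True}"

definition D_alpha ::
  "int ^ ('d::finite + 'd) ^ ('d + 'd) \<Rightarrow> complex ^ 'd ^ 'd \<Rightarrow> (complex ^ 'd midx) set set" where
  "D_alpha N \<tau>\<^sub>0 =
     {act p (tilde \<tau>\<^sub>0) | p. p \<in> P_alpha_Rplus N <#>\<^bsub>mat_monoid UNIV\<^esub> Ugrp UNIV}"

text \<open>
  \<open>GSp\<close> acts on the Siegel space by moving the subspace of \<open>\<complex>\<^sup>2\<^sup>d\<close>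
  spanned by the columns of \<open>(\<tau>; 1)\<close>, the filtration on the graded piece of weight \<open>-1\<close>.
\<close>

definition siegel_subspace :: "complex ^ 'd::finite ^ 'd \<Rightarrow> (complex ^ ('d + 'd)) set" where
  "siegel_subspace \<tau> = range (\<lambda>c. stack (\<tau> *v c) c)"

definition H_alpha ::
  "int ^ ('d::finite + 'd) ^ ('d + 'd) \<Rightarrow> complex ^ 'd ^ 'd \<Rightarrow> (complex ^ 'd ^ 'd) set" where
  "H_alpha N \<tau>\<^sub>0 = {\<tau> \<in> siegel. \<exists>(g, \<mu>) \<in> G_alpha_Rplus N.
     (\<lambda>m. g *v m) ` siegel_subspace \<tau>\<^sub>0 = siegel_subspace \<tau>}"

definition D_alpha_fibre ::
  "int ^ ('d::finite + 'd) ^ ('d + 'd) \<Rightarrow> complex ^ 'd ^ 'd \<Rightarrow> complex ^ 'd ^ 'd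
   \<Rightarrow> (complex ^ 'd midx) set set" where
  "D_alpha_fibre N \<tau>\<^sub>0 \<tau> = {F \<in> D_alpha N \<tau>\<^sub>0. \<exists>u v w. F = F0 \<tau> u v w}"


section \<open>The abelian varieties\<close>

definition perA :: "complex ^ 'd::finite ^ 'd \<Rightarrow> complex ^ ('d + 'd) \<Rightarrow> complex ^ 'd" where
  "perA \<tau> y = upper y - \<tau> *v lower y"

definition perB :: "complex ^ 'd::finite ^ 'd \<Rightarrow> complex ^ ('d + 'd) \<Rightarrow> complex ^ 'd" where
  "perB \<tau> x = two_pi_i *s (upper x v* \<tau> + lower x)"

definition avA :: "complex ^ 'd::finite ^ 'd \<Rightarrow> (complex ^ 'd) set monoid" where
  "avA \<tau> = vec_group Mod (perA \<tau> ` vecs \<int>)"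

definition avB :: "complex ^ 'd::finite ^ 'd \<Rightarrow> (complex ^ 'd) set monoid" where
  "avB \<tau> = vec_group Mod (perB \<tau> ` vecs \<int>)"

definition clsA :: "complex ^ 'd::finite ^ 'd \<Rightarrow> complex ^ 'd \<Rightarrow> (complex ^ 'd) set" where
  "clsA \<tau> v = (perA \<tau> ` vecs \<int>) #>\<^bsub>vec_group\<^esub> v"

definition clsB :: "complex ^ 'd::finite ^ 'd \<Rightarrow> complex ^ 'd \<Rightarrow> (complex ^ 'd) set" where
  "clsB \<tau> u = (perB \<tau> ` vecs \<int>) #>\<^bsub>vec_group\<^esub> u"

text \<open>The point of \<open>B\<^sub>\<tau>\<close> with real coordinates \<open>x\<close>.\<close>

definition ptB :: "complex ^ 'd::finite ^ 'd \<Rightarrow> real ^ ('d + 'd) \<Rightarrow> (complex ^ 'd) set" where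
  "ptB \<tau> x = clsB \<tau> (perB \<tau> (cvec x))"

definition holo_fun :: "(complex ^ 'm::finite) set \<Rightarrow> (complex ^ 'm \<Rightarrow> complex) \<Rightarrow> bool" where
  "holo_fun S f \<longleftrightarrow> (\<forall>x\<in>S. \<exists>L. (f has_derivative L) (at x) \<and> (\<forall>c h. L (c *s h) = c * L h))"

definition holo_map ::
  "(complex ^ 'm::finite) set \<Rightarrow> (complex ^ 'm \<Rightarrow> complex ^ 'n::finite) \<Rightarrow> bool" where
  "holo_map S f \<longleftrightarrow> (\<forall>i. holo_fun S (\<lambda>x. f x $ i))"

text \<open>
  A map \<open>\<phi>\<close> between manifolds that are quotients, by covering maps \<open>q1\<close> and \<open>q2\<close>, of vector
  spaces has a regularity property \<open>C\<close> if it locally lifts to a map with this property.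
\<close>

definition locally_lifts ::
  "(('a::topological_space) set \<Rightarrow> ('a \<Rightarrow> 'b) \<Rightarrow> bool) \<Rightarrow> ('a \<Rightarrow> 'p) \<Rightarrow> ('b \<Rightarrow> 'q) \<Rightarrow> ('p \<Rightarrow> 'q) \<Rightarrow> bool"
  where
  "locally_lifts C q1 q2 \<phi> \<longleftrightarrow>
     (\<forall>p. \<exists>N \<sigma>. open N \<and> p \<in> N \<and> C N \<sigma> \<and> (\<forall>r\<in>N. \<phi> (q1 r) = q2 (\<sigma> r)))"

text \<open>By GAGA, morphisms of abelian varieties are the holomorphic homomorphisms.\<close>

definition av_morphism ::
  "complex ^ 'd::finite ^ 'd \<Rightarrow> ((complex ^ 'd) set \<Rightarrow> (complex ^ 'd) set) \<Rightarrow> bool" where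
  "av_morphism \<tau> f \<longleftrightarrow> f \<in> hom (avB \<tau>) (avA \<tau>) \<and> locally_lifts holo_map (clsB \<tau>) (clsA \<tau>) f"

text \<open>
  \<open>N\<close> is the matrix of \<open>f\<close> on lattices: the linear map \<open>L\<close> of tangent spaces which induces \<open>f\<close>
  sends the period \<open>2\<pi>i n\<close> to the period \<open>N n\<^sup>t\<close>.
\<close>

definition lattice_matrix ::
  "complex ^ 'd::finite ^ 'd \<Rightarrow> ((complex ^ 'd) set \<Rightarrow> (complex ^ 'd) set)
   \<Rightarrow> int ^ ('d + 'd) ^ ('d + 'd) \<Rightarrow> bool" where
  "lattice_matrix \<tau> f N \<longleftrightarrow> (\<exists>L :: complex ^ 'd ^ 'd.
     (\<forall>u. f (clsB \<tau> u) = clsA \<tau> (L *v u)) \<and>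
     (\<forall>n\<in>vecs \<int>. L *v perB \<tau> n = perA \<tau> (map_matrix of_int N *v n)))"


section \<open>The Poincare torsor\<close>

definition pt ::
  "complex ^ 'd::finite ^ 'd \<Rightarrow> complex ^ 'd \<Rightarrow> complex ^ 'd \<Rightarrow> complex
   \<Rightarrow> (complex ^ 'd midx) set set" where
  "pt \<tau> u v w = orbit (mat_monoid (Pu \<int>)) act (F0 \<tau> u v w)"

definition poincare :: "complex ^ 'd::finite ^ 'd \<Rightarrow> (complex ^ 'd midx) set set set" where
  "poincare \<tau> = orbits (mat_monoid (Pu \<int>)) (D_fibre \<tau>) act"

text \<open>
  A point of the torsor is an orbit in \<open>D_fibre\<close>; the values of \<open>v\<close> and of \<open>u\<close> occurring in it
  form the cosets that are its images in \<open>A\<^sub>\<tau>\<close> and in \<open>B\<^sub>\<tau>\<close>.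
\<close>

definition projA ::
  "complex ^ 'd::finite ^ 'd \<Rightarrow> (complex ^ 'd midx) set set \<Rightarrow> (complex ^ 'd) set" where
  "projA \<tau> e = {v. \<exists>u w. F0 \<tau> u v w \<in> e}"

definition projB ::
  "complex ^ 'd::finite ^ 'd \<Rightarrow> (complex ^ 'd midx) set set \<Rightarrow> (complex ^ 'd) set" where
  "projB \<tau> e = {u. \<exists>v w. F0 \<tau> u v w \<in> e}"

definition poincare_fibre ::
  "complex ^ 'd::finite ^ 'd \<Rightarrow> (complex ^ 'd) set \<Rightarrow> (complex ^ 'd) set
   \<Rightarrow> (complex ^ 'd midx) set set set" where
  "poincare_fibre \<tau> a b = {e \<in> poincare \<tau>. projA \<tau> e = a \<and> projB \<tau> e = b}"

text \<open>
  The action of \<open>\<complex>\<^sup>\<times>\<close>, identified with \<open>U(\<complex>) / U(\<int>)\<close> by \<open>z \<mapsto> exp(2\<pi>i z)\<close>.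
\<close>

definition torsor_act ::
  "complex ^ 'd::finite ^ 'd \<Rightarrow> complex \<Rightarrow> (complex ^ 'd midx) set set
   \<Rightarrow> (complex ^ 'd midx) set set" where
  "torsor_act \<tau> t e = {F0 \<tau> u v (w + s) | u v w s. F0 \<tau> u v w \<in> e \<and> exp s = t}"

text \<open>
  The two partial group laws. For fixed \<open>u\<close>, the points of the torsor over the class of \<open>u\<close> are
  the quotient of the space of the \<open>(v, w)\<close> by the translations
  \<open>(y\<^sub>1 - \<tau> y\<^sub>2, 2\<pi>i z - u y\<^sub>2)\<close> with integral \<open>y\<close>, \<open>z\<close>, and \<open>add_over_B\<close> is its addition.
  For fixed \<open>v\<close>, the points over the class of \<open>v\<close> are the quotient of the
  space of the \<open>(u, w)\<close> by the translations
  \<open>(2\<pi>i (x\<^sub>1 \<tau> + x\<^sub>2), 2\<pi>i (z + x\<^sub>1 v))\<close>, and \<open>add_over_A\<close> is its addition.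
\<close>

definition add_over_B ::
  "complex ^ 'd::finite ^ 'd \<Rightarrow> (complex ^ 'd midx) set set \<Rightarrow> (complex ^ 'd midx) set set
   \<Rightarrow> (complex ^ 'd midx) set set" where
  "add_over_B \<tau> e e' = {F0 \<tau> u (v + v') (w + w') | u v v' w w'.
     F0 \<tau> u v w \<in> e \<and> F0 \<tau> u v' w' \<in> e'}"

definition add_over_A ::
  "complex ^ 'd::finite ^ 'd \<Rightarrow> (complex ^ 'd midx) set set \<Rightarrow> (complex ^ 'd midx) set set
   \<Rightarrow> (complex ^ 'd midx) set set" where
  "add_over_A \<tau> e e' = {F0 \<tau> (u + u') v (w + w') | u u' v w w'.
     F0 \<tau> u v w \<in> e \<and> F0 \<tau> u' v w' \<in> e'}"

text \<open>The extension of \<open>A\<^sub>\<tau>\<close> by \<open>\<complex>\<^sup>\<times>\<close> corresponding to the point \<open>b\<close> of \<open>B\<^sub>\<tau>\<close>.\<close>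

definition ext_group ::
  "complex ^ 'd::finite ^ 'd \<Rightarrow> (complex ^ 'd) set \<Rightarrow> (complex ^ 'd midx) set set monoid" where
  "ext_group \<tau> b =
     (let E = {e \<in> poincare \<tau>. projB \<tau> e = b} in
      \<lparr>carrier = E, mult = add_over_B \<tau>,
       one = (THE e. e \<in> E \<and> (\<forall>e'\<in>E. add_over_B \<tau> e e' = e'))\<rparr>)"

definition unit_section ::
  "complex ^ 'd::finite ^ 'd \<Rightarrow> (complex ^ 'd) set \<Rightarrow> (complex ^ 'd midx) set set" where
  "unit_section \<tau> b = \<one>\<^bsub>ext_group \<tau> b\<^esub>"

text \<open>
  The dual \<open>g\<close> of \<open>f\<close>. The point \<open>b\<close>, the class of \<open>u\<close>, corresponds to the extension \<open>E\<^sub>b\<close> of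
  \<open>A\<^sub>\<tau>\<close>; its pullback by \<open>f\<close> is an extension of \<open>B\<^sub>\<tau>\<close> by \<open>\<complex>\<^sup>\<times>\<close>, whose points over \<open>b'\<close> are the
  points of the torsor over \<open>(f b', b)\<close>. The point \<open>a\<close> of \<open>A\<^sub>\<tau>\<close> corresponds to the extension of
  \<open>B\<^sub>\<tau>\<close> formed by the points of the torsor over \<open>a\<close>. Then \<open>g b = a\<close> means that the
  latter, for \<open>a\<close> the class of \<open>v\<close>, is isomorphic to the former, by \<open>\<phi> b'\<close> over
  \<open>b'\<close>. A morphism that induces the identity on \<open>\<complex>\<^sup>\<times>\<close> and on \<open>B\<^sub>\<tau>\<close> is bijective, and because of its
  equivariance it is holomorphic as soon as it is so on local holomorphic sections.
\<close>

definition dual_morphism ::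
  "complex ^ 'd::finite ^ 'd \<Rightarrow> ((complex ^ 'd) set \<Rightarrow> (complex ^ 'd) set)
   \<Rightarrow> ((complex ^ 'd) set \<Rightarrow> (complex ^ 'd) set) \<Rightarrow> bool" where
  "dual_morphism \<tau> f g \<longleftrightarrow> av_morphism \<tau> g \<and>
     (\<forall>u v. g (clsB \<tau> u) = clsA \<tau> v \<longrightarrow> (\<exists>\<phi>.
        (\<forall>b'\<in>carrier (avB \<tau>). \<forall>e\<in>poincare_fibre \<tau> (f b') (clsB \<tau> u).
           \<phi> b' e \<in> poincare_fibre \<tau> (clsA \<tau> v) b' \<and>
           (\<forall>t. t \<noteq> 0 \<longrightarrow> \<phi> b' (torsor_act \<tau> t e) = torsor_act \<tau> t (\<phi> b' e))) \<and>
        (\<forall>b'\<in>carrier (avB \<tau>). \<forall>b''\<in>carrier (avB \<tau>).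
         \<forall>e'\<in>poincare_fibre \<tau> (f b') (clsB \<tau> u). \<forall>e''\<in>poincare_fibre \<tau> (f b'') (clsB \<tau> u).
           \<phi> (b' \<otimes>\<^bsub>avB \<tau>\<^esub> b'') (add_over_B \<tau> e' e'') = add_over_A \<tau> (\<phi> b' e') (\<phi> b'' e'')) \<and>
        (\<forall>p. \<exists>N F h. open N \<and> p \<in> N \<and> holo_map N F \<and> holo_fun N h \<and>
           (\<forall>q\<in>N. f (clsB \<tau> q) = clsA \<tau> (F q) \<and>
              \<phi> (clsB \<tau> q) (pt \<tau> u (F q) 0) = pt \<tau> q v (h q)))))"


section \<open>The Ribet section\<close>

text \<open>
  \<open>s\<close> is a holomorphic section of the restriction of the torsor to the graph of the morphism
  \<open>B\<^sub>\<tau> \<rightarrow> A\<^sub>\<tau>\<close> induced by \<open>N\<close>, that is, the one sending the class of \<open>2\<pi>i (x\<^sub>1 \<tau> + x\<^sub>2)\<close> to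
  that of \<open>y\<^sub>1 - \<tau> y\<^sub>2\<close> where \<open>y = N x\<^sup>t\<close>, with value \<open>1\<close> at the origin. (A section of the
  quotient of the period space has local lifts of the form
  \<open>q \<mapsto> (q, v q, w q)\<close>, as the translations in \<open>u\<close> by the periods are part of \<open>P\<^sup>u(\<int>)\<close>.)
\<close>

definition is_ribet_section ::
  "complex ^ 'd::finite ^ 'd \<Rightarrow> int ^ ('d + 'd) ^ ('d + 'd)
   \<Rightarrow> ((complex ^ 'd) set \<Rightarrow> (complex ^ 'd midx) set set) \<Rightarrow> bool" where
  "is_ribet_section \<tau> N s \<longleftrightarrow>
     (\<forall>x. s (ptB \<tau> x) \<in>
        poincare_fibre \<tau> (clsA \<tau> (perA \<tau> (map_matrix of_int N *v cvec x))) (ptB \<tau> x)) \<and>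
     (\<forall>p. \<exists>O' v w. open O' \<and> p \<in> O' \<and> holo_map O' v \<and> holo_fun O' w \<and>
        (\<forall>q\<in>O'. s (clsB \<tau> q) = pt \<tau> q (v q) (w q))) \<and>
     s \<one>\<^bsub>avB \<tau>\<^esub> = unit_section \<tau> \<one>\<^bsub>avB \<tau>\<^esub>"

definition ribet_section ::
  "complex ^ 'd::finite ^ 'd \<Rightarrow> int ^ ('d + 'd) ^ ('d + 'd)
   \<Rightarrow> (complex ^ 'd) set \<Rightarrow> (complex ^ 'd midx) set set" where
  "ribet_section \<tau> N =
     (THE s. s \<in> extensional (carrier (avB \<tau>)) \<and> is_ribet_section \<tau> N s)"


section \<open>Real Lie groups\<close>

primrec Ck ::
  "nat \<Rightarrow> ('a::real_normed_vector) set \<Rightarrow> ('a \<Rightarrow> 'b::real_normed_vector) \<Rightarrow> bool" where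
  "Ck 0 S f \<longleftrightarrow> continuous_on S f"
| "Ck (Suc k) S f \<longleftrightarrow>
     (\<exists>f'. (\<forall>x\<in>S. (f has_derivative f' x) (at x)) \<and> (\<forall>h. Ck k S (\<lambda>x. f' x h)))"

definition smooth ::
  "('a::real_normed_vector) set \<Rightarrow> ('a \<Rightarrow> 'b::real_normed_vector) \<Rightarrow> bool" where
  "smooth S f \<longleftrightarrow> (\<forall>k. Ck k S f)"

text \<open>An isomorphism of groups that is a diffeomorphism, for manifolds that are quotients of
  vector spaces by \<open>q1\<close> and \<open>q2\<close>.\<close>

definition lie_iso ::
  "(('a::real_normed_vector) \<Rightarrow> 'p) \<Rightarrow> ('p, 'x) monoid_scheme
   \<Rightarrow> (('b::real_normed_vector) \<Rightarrow> 'q) \<Rightarrow> ('q, 'y) monoid_scheme \<Rightarrow> ('p \<Rightarrow> 'q) \<Rightarrow> bool" where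
  "lie_iso q1 G q2 H \<phi> \<longleftrightarrow> \<phi> \<in> iso G H \<and> locally_lifts smooth q1 q2 \<phi> \<and>
     locally_lifts smooth q2 q1 (inv_into (carrier G) \<phi>)"

text \<open>The group \<open>\<complex>/2\<pi>i\<int> \<times> \<real>\<^sup>2\<^sup>d/\<int>\<^sup>2\<^sup>d\<close> and the quotient map onto it.\<close>

definition std_group :: "((complex set) \<times> ((real ^ ('d::finite + 'd)) set)) monoid" where
  "std_group =
     (vec_group Mod range (\<lambda>k::int. two_pi_i * of_int k)) \<times>\<times> (vec_group Mod vecs \<int>)"

definition std_cls ::
  "complex \<times> (real ^ ('d::finite + 'd)) \<Rightarrow> complex set \<times> (real ^ ('d + 'd)) set" where
  "std_cls = (\<lambda>(s, y). (range (\<lambda>k::int. two_pi_i * of_int k) #>\<^bsub>vec_group\<^esub> s,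
                        vecs \<int> #>\<^bsub>vec_group\<^esub> y))"

definition p_x :: "real ^ ('d::finite + 'd) \<Rightarrow> complex ^ 'd midx ^ 'd midx" where
  "p_x x = block 1 (mat 1) (cvec x) 0 0"

definition p_zy :: "complex \<Rightarrow> real ^ ('d::finite + 'd) \<Rightarrow> complex ^ 'd midx ^ 'd midx" where
  "p_zy z y = block 1 (mat 1) 0 (cvec y) z"

end

theory Submission
  imports Defs "HOL-Complex_Analysis.Cauchy_Integral_Formula"
begin

text \<open>
  Everything is computed in the coordinates \<open>(u, v, w)\<close> of \<open>F\<^sup>0\<close>, in which \<open>P\<^sup>u(\<int>)\<close> acts by explicit
  translations. Put \<open>u = perB x\<close> with \<open>x\<close> real. The identity
  \<open>2\<pi>i x\<cdot>y = 2\<pi>i x\<^sub>1\<cdot>perA y + perB x\<cdot>y\<^sub>2\<close> and the symmetry of \<open>\<alpha>\<^sub>Z\<close> show that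
  \<open>R(u, u') = 2\<pi>i x\<^sub>1\<cdot>\<alpha>u' - u'\<cdot>(\<alpha>\<^sub>Z x)\<^sub>2\<close> is symmetric, hence complex bilinear, so that
  \<open>u \<mapsto> (u, \<alpha>u, R(u, u)/2)\<close> is holomorphic; since \<open>\<alpha>\<^sub>Z = f\<^sub>Z + f\<^sub>Z\<^sup>t\<close> it descends to \<open>B\<^sub>\<tau>\<close>. By Liouville's
  theorem it is the only section with value \<open>1\<close> at the origin, and
  \<open>R(u, u)/2 = 2\<pi>i x f\<^sub>Z x\<^sup>t - u\<cdot>(\<alpha>\<^sub>Z x)\<^sub>2\<close>.

  That the dual of \<open>f\<close> has lattice matrix \<open>-f\<^sub>Z\<^sup>t\<close> also comes from Liouville's theorem: an isomorphism
  between the two extensions of \<open>B\<close> is, up to an elementary factor, an entire function which a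
  period \<open>n\<close> multiplies by \<open>exp(2\<pi>i m\<cdot>n)\<close>, where \<open>m = (f\<^sub>Z\<^sup>t + h) x\<close> and \<open>h\<close> is the lattice matrix of the
  dual. It is thus constant, \<open>m\<close> is integral for all real \<open>x\<close>, and \<open>h = -f\<^sub>Z\<^sup>t\<close>.
\<close>

section \<open>Vectors and periods\<close>

lemma upper_simps [simp]:
  "upper (a + b) = upper a + upper b" "upper (a - b) = upper a - upper b" "upper (- a) = - upper a"
  "upper 0 = 0" "upper (c *s a') = c *s upper a'" "upper (stack r s) = r"
  by (simp_all add: upper_def stack_def vec_eq_iff)

lemma lower_simps [simp]:
  "lower (a + b) = lower a + lower b" "lower (a - b) = lower a - lower b" "lower (- a) = - lower a"
  "lower 0 = 0" "lower (c *s a') = c *s lower a'" "lower (stack r s) = s"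
  by (simp_all add: lower_def stack_def vec_eq_iff)

lemma stack_upper_lower [simp]: "stack (upper x) (lower x) = x"
  by (simp add: vec_eq_iff stack_def upper_def lower_def split: sum.split)

lemma stack_simps:
  "stack a b + stack a' b' = stack (a + a') (b + b')" "c *s stack a'' b'' = stack (c *s a'') (c *s b'')"
  by (simp_all add: vec_eq_iff stack_def split: sum.split)

lemma stack_eq_iff: "stack a b = stack a' b' \<longleftrightarrow> a = a' \<and> b = b'"
  by (metis upper_simps(6) lower_simps(6))

section \<open>The complex bilinear pairing of vectors\<close>

lemma dotc_simps [simp]:
  "dotc (a + b) c = dotc a c + dotc b c" "dotc a (b + c) = dotc a b + dotc a c"
  "dotc (a - b) c = dotc a c - dotc b c" "dotc a (b - c) = dotc a b - dotc a c"
  "dotc (- a) c = - dotc a c" "dotc a (- c) = - dotc a c"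
  "dotc (k *s a) c = k * dotc a c" "dotc a (k *s c) = k * dotc a c"
  "dotc 0 c = 0" "dotc a 0 = 0"
  by (simp_all add: dotc_def algebra_simps sum.distrib sum_subtractf sum_negf sum_distrib_left)

lemma dotc_commute: "dotc a b = dotc b a"
  by (simp add: dotc_def mult.commute)

lemma dotc_axis [simp]: "dotc a (axis i 1) = a $ i" "dotc (axis i 1) a = a $ i"
proof -
  have "(\<Sum>j\<in>UNIV. a $ j * axis i 1 $ j) = (\<Sum>j\<in>UNIV. if j = i then a $ j else 0)"
    by (rule sum.cong) (auto simp: axis_def)
  then show "dotc a (axis i 1) = a $ i" "dotc (axis i 1) a = a $ i"
    by (simp_all add: dotc_def mult.commute)
qed

lemma dotc_eqI: "(\<And>c. dotc a c = dotc b c) \<Longrightarrow> a = b"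
  by (metis dotc_axis(1) vec_eq_iff)

lemma dotc_vector_matrix: "dotc (x v* A) c = dotc x (A *v c)"
  unfolding dotc_def vector_matrix_mult_def matrix_vector_mult_def
  by (simp add: sum_distrib_left sum_distrib_right mult_ac) (rule sum.swap)

lemma dotc_split: "dotc x y = dotc (upper x) (upper y) + dotc (lower x) (lower y)"
  unfolding dotc_def upper_def lower_def UNIV_Plus_UNIV [symmetric]
  by (subst sum.Plus) (auto simp: o_def)

lemma vec_scale_matrix:
  fixes x :: "complex ^ 'n::finite"
  shows "(k *s x) v* A = k *s (x v* A)" "A *v (k *s x) = k *s (A *v x)"
  by (simp_all add: vec_eq_iff vector_matrix_mult_def matrix_vector_mult_def sum_distrib_left mult_ac)

lemma vector_matrix_linear:
  fixes x y :: "'a::comm_ring_1 ^ 'n::finite"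
  shows "(x + y) v* A = x v* A + y v* A" "(x - y) v* A = x v* A - y v* A" "(- x) v* A = - (x v* A)"
  by (simp_all add: vec_eq_iff vector_matrix_mult_def algebra_simps sum.distrib sum_subtractf sum_negf)

lemma matrix_vector_uminus:
  fixes x :: "'a::comm_ring_1 ^ 'n::finite"
  shows "A *v (- x) = - (A *v x)"
  by (simp add: vec_eq_iff matrix_vector_mult_def sum_negf)

section \<open>The period maps of \<open>A\<close> and \<open>B\<close>\<close>

lemma perA_simps [simp]:
  "perA \<tau> (a + b) = perA \<tau> a + perA \<tau> b" "perA \<tau> (a - b) = perA \<tau> a - perA \<tau> b"
  "perA \<tau> (- a) = - perA \<tau> a" "perA \<tau> 0 = 0" "perA \<tau> (k *s a) = k *s perA \<tau> a"
  by (simp_all add: perA_def algebra_simps matrix_vector_uminus vec_scale_matrix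
      vector_ssub_ldistrib)

lemma perB_simps [simp]:
  "perB \<tau> (a + b) = perB \<tau> a + perB \<tau> b" "perB \<tau> (a - b) = perB \<tau> a - perB \<tau> b"
  "perB \<tau> (- a) = - perB \<tau> a" "perB \<tau> 0 = 0" "perB \<tau> (k *s a) = k *s perB \<tau> a"
  by (simp_all add: perB_def vector_matrix_linear vec_scale_matrix vec_eq_iff algebra_simps)

text \<open>The two terms containing \<open>\<tau>\<close> cancel, since \<open>\<tau>\<close> may
  act on either side of \<open>dotc\<close>. The identity turns the mixed terms of the torsor, one
  in \<open>upper x\<close> and one in \<open>lower y\<close>, into a pairing that is real for real
  coordinates.\<close>

lemma dotc_period:
  "two_pi_i * dotc x y = two_pi_i * dotc (upper x) (perA \<tau> y) + dotc (perB \<tau> x) (lower y)"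
  by (simp add: perA_def perB_def dotc_split [of x y] dotc_vector_matrix algebra_simps)

section \<open>Real and integral vectors inside the complex ones\<close>

lemma cvec_simps [simp]:
  "cvec (a + b) = cvec a + cvec b" "cvec (a - b) = cvec a - cvec b" "cvec (- a) = - cvec a"
  "cvec 0 = 0" "cvec (k *\<^sub>R a) = complex_of_real k *s cvec a"
  by (simp_all add: cvec_def vec_eq_iff)

lemma scaleR_complex_vec: "k *\<^sub>R (x :: complex ^ 'n::finite) = complex_of_real k *s x"
  by (simp add: vec_eq_iff complex_eq_iff)

lemma dotc_cvec: "dotc (cvec x) (cvec y) = of_real (x \<bullet> y)"
  by (simp add: dotc_def cvec_def inner_vec_def)

lemma of_int_matrix_cvec:
  "(map_matrix of_int N :: complex ^ 'n::finite ^ 'm::finite) *v cvec x = cvec (map_matrix of_int N *v x)"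
  by (simp add: vec_eq_iff cvec_def matrix_vector_mult_def map_matrix_def)

lemma vecs_Ints_simps [simp]:
  fixes a b :: "'a::ring_1 ^ 'n::finite"
  shows "a \<in> vecs \<int> \<Longrightarrow> b \<in> vecs \<int> \<Longrightarrow> a + b \<in> vecs \<int>" "a \<in> vecs \<int> \<Longrightarrow> b \<in> vecs \<int> \<Longrightarrow> a - b \<in> vecs \<int>"
    "a \<in> vecs \<int> \<Longrightarrow> - a \<in> vecs \<int>" "0 \<in> (vecs \<int> :: ('a ^ 'n) set)"
  by (auto simp: vecs_def)

lemma vecs_UNIV [simp]: "vecs UNIV = UNIV"
  by (simp add: vecs_def)

lemma of_int_matrix_Ints:
  fixes x :: "'a::comm_ring_1 ^ 'n::finite"
  assumes "x \<in> vecs \<int>"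
  shows "map_matrix of_int N *v x \<in> vecs \<int>"
  using assms by (auto simp: vecs_def matrix_vector_mult_def map_matrix_def intro!: Ints_mult Ints_sum)

lemma dotc_Ints: "x \<in> vecs \<int> \<Longrightarrow> y \<in> vecs \<int> \<Longrightarrow> dotc x y \<in> \<int>"
  by (auto simp: vecs_def dotc_def intro!: Ints_mult Ints_sum)

lemma vecs_Reals: "vecs \<real> = range cvec"
proof (rule Set.set_eqI, rule iffI)
  fix x :: "complex ^ 'n" assume "x \<in> vecs \<real>"
  then have "x = cvec (\<chi> i. Re (x $ i))"
    by (auto simp: vecs_def cvec_def vec_eq_iff)
  then show "x \<in> range cvec" by blast
qed (auto simp: vecs_def cvec_def)

lemma vecs_Ints_complex: "(vecs \<int> :: (complex ^ 'n::finite) set) = cvec ` vecs \<int>"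
proof (rule Set.set_eqI, rule iffI)
  fix x :: "complex ^ 'n" assume x: "x \<in> vecs \<int>"
  then have re: "Re (x $ i) \<in> \<int>" "x $ i = of_real (Re (x $ i))" for i
    by (auto simp: vecs_def elim!: allE [of _ i] Ints_cases)
  then have "x = cvec (\<chi> i. Re (x $ i))" "(\<chi> i. Re (x $ i)) \<in> vecs \<int>"
    by (auto simp: vecs_def cvec_def vec_eq_iff)
  then show "x \<in> cvec ` vecs \<int>" by blast
qed (auto simp: vecs_def cvec_def)

lemma complex_of_real_Ints_iff: "complex_of_real r \<in> \<int> \<longleftrightarrow> r \<in> \<int>"
proof
  assume "complex_of_real r \<in> \<int>"
  then obtain k where "complex_of_real r = of_int k" by (auto elim: Ints_cases)
  then have "r = of_int k" by (metis of_real_eq_iff of_real_of_int_eq)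
  then show "r \<in> \<int>" by simp
qed auto

lemma cvec_Ints_iff [simp]: "cvec x \<in> vecs \<int> \<longleftrightarrow> x \<in> vecs \<int>"
  by (simp add: vecs_def cvec_def complex_of_real_Ints_iff)

lemma cvec_inj [simp]: "cvec x = cvec y \<longleftrightarrow> x = y"
  by (simp add: cvec_def vec_eq_iff)

lemma linear_perA_cvec: "linear (\<lambda>y. perA \<tau> (cvec y))"
  and linear_perB_cvec: "linear (\<lambda>y. perB \<tau> (cvec y))"
  by (auto intro!: linearI simp: scaleR_complex_vec)

section \<open>The Siegel space and the action on filtrations\<close>

lemma two_pi_i_nonzero: "two_pi_i \<noteq> 0" by simp

lemma Im_dotc_cvec: "Im (dotc (cvec x) v) = x \<bullet> (\<chi> i. Im (v $ i))"
  by (simp add: dotc_def cvec_def inner_vec_def)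

lemma Im_matrix_cvec: "(\<chi> i. Im ((\<tau> *v cvec y) $ i)) = map_matrix Im \<tau> *v y"
  by (simp add: matrix_vector_mult_def cvec_def map_matrix_def vec_eq_iff)

text \<open>Pairing the equation with \<open>y\<close> makes the right side real, while the
  imaginary part of the left side is the positive definite form of \<open>\<tau>\<close> at
  \<open>y\<close>.\<close>

lemma siegel_real_solution:
  assumes "\<tau> \<in> siegel" and "\<tau> *v cvec y = cvec x"
  shows "y = 0"
proof (rule ccontr)
  assume "y \<noteq> 0"
  then have "0 < y \<bullet> (map_matrix Im \<tau> *v y)"
    using assms(1) by (simp add: siegel_def)
  also have "\<dots> = Im (dotc (cvec y) (\<tau> *v cvec y))"
    by (simp add: Im_dotc_cvec Im_matrix_cvec)
  also have "\<dots> = 0"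
    by (simp add: assms(2) dotc_cvec)
  finally show False by simp
qed

lemma upper_cvec: "upper (cvec x) = cvec (upper x)"
  and lower_cvec: "lower (cvec x) = cvec (lower x)"
  by (simp_all add: upper_def lower_def cvec_def vec_eq_iff)

lemma siegel_transpose: "\<tau> \<in> siegel \<Longrightarrow> transpose \<tau> = \<tau>"
  by (simp add: siegel_def)

lemma perA_cvec_eq_0:
  assumes "\<tau> \<in> siegel" and "perA \<tau> (cvec y) = 0"
  shows "y = 0"
proof -
  have eq: "\<tau> *v cvec (lower y) = cvec (upper y)"
    using assms(2) by (simp add: perA_def upper_cvec lower_cvec)
  then have "lower y = 0"
    using siegel_real_solution [OF assms(1)] by blast
  moreover have "upper y = 0"
  proof -
    have "cvec (upper y) = cvec 0" using eq \<open>lower y = 0\<close> by simp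
    then show ?thesis by (simp only: cvec_inj)
  qed
  ultimately show "y = 0"
    by (metis stack_upper_lower stack_simps(1) upper_simps(4) lower_simps(4))
qed

lemma perB_cvec_eq_0:
  assumes "\<tau> \<in> siegel" and "perB \<tau> (cvec x) = 0"
  shows "x = 0"
proof -
  have eq0: "cvec (upper x) v* \<tau> + cvec (lower x) = 0"
    using assms(2) two_pi_i_nonzero
    by (simp only: perB_def upper_cvec lower_cvec vec.scale_eq_0_iff) blast
  \<comment> \<open>The symmetry of \<open>\<tau>\<close> turns the row equation into a column
    equation.\<close>
  have "\<tau> *v cvec (upper x) = cvec (upper x) v* \<tau>"
    by (metis assms(1) siegel_transpose vector_transpose_matrix)
  also have "\<dots> = cvec (- lower x)"
    using eq0 by (simp add: eq_neg_iff_add_eq_0)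
  finally have "upper x = 0"
    using siegel_real_solution [OF assms(1)] by blast
  moreover have "lower x = 0"
  proof -
    have "cvec (lower x) = cvec 0" using eq0 \<open>upper x = 0\<close> by simp
    then show ?thesis by (simp only: cvec_inj)
  qed
  ultimately show "x = 0"
    by (metis stack_upper_lower stack_simps(1) upper_simps(4) lower_simps(4))
qed

text \<open>Serves for \<open>perA\<close> and \<open>perB\<close> on real vectors: source and
  target both have real dimension \<open>2d\<close>, so injectivity suffices, and the inverse is
  continuous.\<close>

lemma linear_iso_dim:
  fixes h :: "'a::euclidean_space \<Rightarrow> 'b::euclidean_space"
  assumes "linear h" and "\<And>x. h x = 0 \<Longrightarrow> x = 0" and "DIM('a) = DIM('b)"
  shows "bij h" and "bounded_linear (inv_into UNIV h)"
proof -
  have inj: "inj h"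
    using assms(1,2) linear_injective_0 by blast
  moreover have "surj h"
    using linear_injective_imp_surjective [OF assms(1) inj] assms(3) by simp
  ultimately show "bij h" by (simp add: bij_def)
  then have hi: "h (inv_into UNIV h z) = z" and ih: "inv_into UNIV h (h y) = y" for z y
    by (simp_all add: bij_is_surj surj_f_inv_f bij_is_inj)
  have "linear (inv_into UNIV h)"
  proof (rule linearI)
    fix a b :: 'b and r :: real
    have "a + b = h (inv_into UNIV h a + inv_into UNIV h b)"
      by (simp add: linear_add [OF assms(1)] hi)
    then show "inv_into UNIV h (a + b) = inv_into UNIV h a + inv_into UNIV h b"
      by (simp only: ih)
    have "r *\<^sub>R a = h (r *\<^sub>R inv_into UNIV h a)"
      by (simp add: linear_scale [OF assms(1)] hi)
    then show "inv_into UNIV h (r *\<^sub>R a) = r *\<^sub>R inv_into UNIV h a"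
      by (simp only: ih)
  qed
  then show "bounded_linear (inv_into UNIV h)"
    by (simp add: linear_conv_bounded_linear)
qed

lemma perA_cvec_iso:
  assumes "\<tau> \<in> siegel"
  shows "bij (\<lambda>y. perA \<tau> (cvec y))" "bounded_linear (inv_into UNIV (\<lambda>y. perA \<tau> (cvec y)))"
  by (rule linear_iso_dim; use linear_perA_cvec perA_cvec_eq_0 [OF assms] in auto)+

lemma perB_cvec_iso:
  assumes "\<tau> \<in> siegel"
  shows "bij (\<lambda>y. perB \<tau> (cvec y))" "bounded_linear (inv_into UNIV (\<lambda>y. perB \<tau> (cvec y)))"
  by (rule linear_iso_dim; use linear_perB_cvec perB_cvec_eq_0 [OF assms] in auto)+

lemma perA_real_ex: "\<tau> \<in> siegel \<Longrightarrow> \<exists>y. v = perA \<tau> (cvec y)"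
  and perB_real_ex: "\<tau> \<in> siegel \<Longrightarrow> \<exists>x. u = perB \<tau> (cvec x)"
  by (metis bij_pointE perA_cvec_iso(1), metis bij_pointE perB_cvec_iso(1))

lemma perA_real_inj: "\<tau> \<in> siegel \<Longrightarrow> perA \<tau> (cvec y) = perA \<tau> (cvec y') \<longleftrightarrow> y = y'"
  and perB_real_inj: "\<tau> \<in> siegel \<Longrightarrow> perB \<tau> (cvec x) = perB \<tau> (cvec x') \<longleftrightarrow> x = x'"
  using perA_cvec_iso(1) [THEN bij_is_inj] perB_cvec_iso(1) [THEN bij_is_inj] by (auto dest: injD)

section \<open>Block matrices acting on filtrations\<close>

lemma col_simps [simp]:
  "col a m b = col a' m' b' \<longleftrightarrow> a = a' \<and> m = m' \<and> b = b'"
  by (auto simp: col_def vec_eq_iff split: sum.splits)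

text \<open>The identity blocks at the bottom of the period matrix make the parameters
  \<open>c\<close> and \<open>t\<close> of a vector unique. The vector with \<open>c = 0\<close>,
  \<open>t = 1\<close> then shows \<open>v\<close> and \<open>w\<close>, those with
  \<open>t = 0\<close> show \<open>u\<close>.\<close>

lemma F0_inj [simp]: "F0 \<tau> u v w = F0 \<tau> u' v' w' \<longleftrightarrow> u = u' \<and> v = v' \<and> w = w'"
proof (rule iffI)
  assume eq: "F0 \<tau> u v w = F0 \<tau> u' v' w'"
  have mem: "\<exists>c' t'. col (dotc u c + w * t) (stack (\<tau> *v c + t *s v) c) t
      = col (dotc u' c' + w' * t') (stack (\<tau> *v c' + t' *s v') c') t'" for c t
  proof -
    have "col (dotc u c + w * t) (stack (\<tau> *v c + t *s v) c) t \<in> F0 \<tau> u v w"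
      unfolding F0_def by blast
    then have "col (dotc u c + w * t) (stack (\<tau> *v c + t *s v) c) t \<in> F0 \<tau> u' v' w'"
      by (simp only: eq)
    then show ?thesis by (auto simp add: F0_def simp del: col_simps)
  qed
  have "v = v' \<and> w = w'"
    using mem [of 0 1] by (auto simp: stack_eq_iff)
  moreover have "u = u'"
  proof (rule dotc_eqI)
    show "dotc u c = dotc u' c" for c
      using mem [of c 0] by (auto simp: stack_eq_iff)
  qed
  ultimately show "u = u' \<and> v = v' \<and> w = w'" by simp
qed simp

lemma sum_UNIV_Plus: "(\<Sum>i\<in>UNIV. h i) = (\<Sum>k\<in>UNIV. h (Inl k)) + (\<Sum>k\<in>UNIV. h (Inr k))"
  for h :: "'a::finite + 'b::finite \<Rightarrow> complex"
  by (simp add: UNIV_Plus_UNIV [symmetric] sum.Plus o_def del: UNIV_Plus_UNIV)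

lemma sum_midx: "(\<Sum>i\<in>UNIV. h i) = h (Inl ()) + (\<Sum>k\<in>UNIV. h (Inr (Inl k))) + h (Inr (Inr ()))"
  for h :: "'d::finite midx \<Rightarrow> complex"
  using sum_UNIV_Plus [of h] sum_UNIV_Plus [of "\<lambda>k. h (Inr k)"] by (simp add: UNIV_unit)

lemma block_mult_col: "block \<mu> g x y z *v col a m b = col (\<mu> * a + dotc x m + z * b) (g *v m + b *s y) b"
  by (simp add: vec_eq_iff matrix_vector_mult_def block_def col_def sum_midx dotc_def mult.commute split: sum.split)

lemma block_mult_block:
  "block \<mu> g x y z ** block \<mu>' g' x' y' z' =
    block (\<mu> * \<mu>') (g ** g') (\<mu> *s x' + x v* g') (g *v y' + y) (\<mu> * z' + dotc x y' + z)"
  by (simp add: vec_eq_iff matrix_matrix_mult_def matrix_vector_mult_def vector_matrix_mult_def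
      block_def sum_midx dotc_def mult.commute split: sum.split)

lemma block_eq_iff: "block \<mu> g x y z = block \<mu>' g' x' y' z' \<longleftrightarrow>
    \<mu> = \<mu>' \<and> g = g' \<and> x = x' \<and> y = y' \<and> z = z'"
proof
  assume eq: "block \<mu> g x y z = block \<mu>' g' x' y' z'"
  have "block \<mu> g x y z $ i $ j = block \<mu>' g' x' y' z' $ i $ j" for i j
    by (simp add: eq)
  from this [of "Inl ()" "Inl ()"] this [of "Inl ()" "Inr (Inl b)" for b]
    this [of "Inr (Inl a)" "Inr (Inl b)" for a b] this [of "Inl ()" "Inr (Inr ())"]
    this [of "Inr (Inl a)" "Inr (Inr ())" for a]
  show "\<mu> = \<mu>' \<and> g = g' \<and> x = x' \<and> y = y' \<and> z = z'"
    by (simp add: block_def vec_eq_iff)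
qed simp

lemma block_1: "block 1 (mat 1) 0 0 0 = mat 1"
  by (auto simp: vec_eq_iff block_def mat_def split: sum.split)

lemma scale0_col: "scale0 k (col a m b) = col (k * a) m b"
  by (simp add: vec_eq_iff scale0_def col_def split: sum.split)

lemma scale0_scale0: "k \<noteq> 0 \<Longrightarrow> scale0 (1 / k) (scale0 k m) = m"
  by (simp add: vec_eq_iff scale0_def split: sum.split)

lemma act_act: "act p (act q F) = act (p ** q) F"
  by (simp add: act_def image_image scale0_scale0 matrix_vector_mul_assoc)

text \<open>Adding \<open>t *s y\<close> spoils the identity block at the bottom. Replacing the
  parameter \<open>c\<close> by \<open>c + t *s lower y\<close> restores it; this subtracts
  \<open>\<tau> *v lower y\<close> from the \<open>v\<close>-part, whence \<open>perA\<close>, and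
  produces the term with \<open>lower y\<close> in the last coordinate.\<close>

lemma act_F0:
  "act (block 1 (mat 1) x y z) (F0 \<tau> u v w) =
    F0 \<tau> (u + perB \<tau> x) (v + perA \<tau> y)
      (w + two_pi_i * (z + dotc (upper x) v) - dotc (u + perB \<tau> x) (lower y))"
    (is "_ = F0 \<tau> ?u ?v ?w")
proof -
  have scale_cancel: "k * (1 / k * a + b + c) = a + k * (b + c)" if "k \<noteq> 0" for k a b c :: complex
    using that by (simp add: field_simps)
  have eq: "scale0 two_pi_i (block 1 (mat 1) x y z *v
      scale0 (1 / two_pi_i) (col (dotc u c + w * t) (stack (\<tau> *v c + t *s v) c) t)) =
    col (dotc ?u (c + t *s lower y) + ?w * t) (stack (\<tau> *v (c + t *s lower y) + t *s ?v) (c + t *s lower y)) t" for c t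
  proof -
    have m: "stack (\<tau> *v c + t *s v) c + t *s y =
        stack (\<tau> *v (c + t *s lower y) + t *s ?v) (c + t *s lower y)"
    proof -
      have "y = stack (upper y) (lower y)" by simp
      then have "stack (\<tau> *v c + t *s v) c + t *s y =
          stack (\<tau> *v c + t *s v + t *s upper y) (c + t *s lower y)"
        by (metis stack_simps)
      also have "\<tau> *v c + t *s v + t *s upper y = \<tau> *v (c + t *s lower y) + t *s ?v"
        by (simp add: perA_def vec_eq_iff algebra_simps vec_scale_matrix matrix_vector_right_distrib)
      finally show ?thesis .
    qed
    have "two_pi_i * (1 / two_pi_i * (dotc u c + w * t) + dotc x (stack (\<tau> *v c + t *s v) c) + z * t)
      = (dotc u c + w * t) + two_pi_i * (dotc x (stack (\<tau> *v c + t *s v) c) + z * t)"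
      by (rule scale_cancel [OF two_pi_i_nonzero])
    also have "\<dots> = dotc ?u (c + t *s lower y) + ?w * t"
      by (simp add: dotc_split [of x] perB_def dotc_vector_matrix algebra_simps)
    finally show ?thesis
      by (simp add: block_mult_col scale0_col m)
  qed
  show ?thesis
    unfolding act_def F0_def
  proof (rule Set.set_eqI, rule iffI)
    fix F assume "F \<in> {col (dotc ?u c + ?w * t) (stack (\<tau> *v c + t *s ?v) c) t |c t. True}"
    then obtain c t where F: "F = col (dotc ?u c + ?w * t) (stack (\<tau> *v c + t *s ?v) c) t" by blast
    \<comment> \<open>Undoing the change of parameter reaches every vector of the new
      filtration.\<close>
    have "c - t *s lower y + t *s lower y = c" by simp
    then show "F \<in> (\<lambda>m. scale0 two_pi_i (block 1 (mat 1) x y z *v scale0 (1 / two_pi_i) m)) `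
        {col (dotc u c + w * t) (stack (\<tau> *v c + t *s v) c) t |c t. True}"
      unfolding F using eq [of "c - t *s lower y" t] by (metis (mono_tags, lifting) image_eqI mem_Collect_eq)
  qed (use eq in blast)
qed

section \<open>The Poincare torsor and its group laws\<close>

lemma comm_group_vec_group: "comm_group (vec_group :: 'a::ab_group_add monoid)"
proof (rule comm_groupI)
  show "\<exists>y\<in>carrier vec_group. y \<otimes>\<^bsub>vec_group\<^esub> x = \<one>\<^bsub>vec_group\<^esub>" for x :: 'a
    by (rule bexI [of _ "- x"]) (simp_all add: vec_group_def)
qed (simp_all add: vec_group_def algebra_simps)

text \<open>One calculus of cosets for the four subgroups that occur: the periods of
  \<open>A\<close>, those of \<open>B\<close>, the integral vectors, and the integer multiples of
  \<open>two_pi_i\<close>.\<close>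

locale additive_subgroup_of_vectors =
  fixes H :: "'a::ab_group_add set"
  assumes zero_mem: "0 \<in> H"
    and add_mem: "\<And>a b. a \<in> H \<Longrightarrow> b \<in> H \<Longrightarrow> a + b \<in> H"
    and neg_mem: "\<And>a. a \<in> H \<Longrightarrow> - a \<in> H"
begin

lemma subgroup_vec_group: "subgroup H vec_group"
proof (rule group.subgroupI)
  show "group (vec_group :: 'a monoid)"
    using comm_group_vec_group by (rule comm_group.axioms)
  show "inv\<^bsub>vec_group\<^esub> a \<in> H" if "a \<in> H" for a
  proof -
    have "inv\<^bsub>vec_group\<^esub> a = - a"
      by (rule group.inv_equality [OF comm_group.axioms(2) [OF comm_group_vec_group]])
        (simp_all add: vec_group_def)
    then show ?thesis using that neg_mem by simp
  qed
qed (use zero_mem add_mem in \<open>auto simp: vec_group_def\<close>)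

lemma comm_group_Mod: "comm_group (vec_group Mod H)"
  using comm_group.abelian_FactGroup [OF comm_group_vec_group subgroup_vec_group] .

lemma coset_eq: "H #>\<^bsub>vec_group\<^esub> a = {h + a | h. h \<in> H}"
  by (auto simp: r_coset_def vec_group_def)

lemma coset_eq_iff: "H #>\<^bsub>vec_group\<^esub> a = H #>\<^bsub>vec_group\<^esub> b \<longleftrightarrow> a - b \<in> H"
proof
  assume "H #>\<^bsub>vec_group\<^esub> a = H #>\<^bsub>vec_group\<^esub> b"
  moreover have "a \<in> H #>\<^bsub>vec_group\<^esub> a"
    using zero_mem by (force simp: coset_eq)
  ultimately show "a - b \<in> H" by (auto simp: coset_eq)
next
  assume ab: "a - b \<in> H"
  have "\<exists>h'. h + a = h' + b \<and> h' \<in> H" "\<exists>h'. h + b = h' + a \<and> h' \<in> H" if "h \<in> H" for h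
    using add_mem [OF that ab] add_mem [OF that neg_mem [OF ab]]
    by (intro exI [of _ "h + (a - b)"] exI [of _ "h + - (a - b)"], simp)+
  then show "H #>\<^bsub>vec_group\<^esub> a = H #>\<^bsub>vec_group\<^esub> b"
    by (auto simp: coset_eq)
qed

lemma carrier_Mod: "carrier (vec_group Mod H) = range (\<lambda>a. H #>\<^bsub>vec_group\<^esub> a)"
  by (simp add: carrier_FactGroup) (simp add: vec_group_def)

lemma mult_Mod:
  "(H #>\<^bsub>vec_group\<^esub> a) \<otimes>\<^bsub>vec_group Mod H\<^esub> (H #>\<^bsub>vec_group\<^esub> b) = H #>\<^bsub>vec_group\<^esub> (a + b)"
proof -
  have "H \<lhd> vec_group"
    using comm_group.subgroup_imp_normal [OF comm_group_vec_group subgroup_vec_group] .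
  from normal.rcos_sum [OF this, of a b] show ?thesis
    by (simp add: vec_group_def)
qed

lemma one_Mod: "\<one>\<^bsub>vec_group Mod H\<^esub> = H #>\<^bsub>vec_group\<^esub> 0"
  by (simp add: coset_eq)

lemma inv_Mod: "inv\<^bsub>vec_group Mod H\<^esub> (H #>\<^bsub>vec_group\<^esub> a) = H #>\<^bsub>vec_group\<^esub> (- a)"
  by (rule group.inv_equality [OF comm_group.axioms(2) [OF comm_group_Mod]])
    (simp_all add: mult_Mod one_Mod carrier_Mod del: one_FactGroup mult_FactGroup)

end

lemma additive_subgroup_Ints: "additive_subgroup_of_vectors (vecs \<int> :: ('a::ring_1 ^ 'n::finite) set)"
  by standard auto

lemma additive_subgroup_perA: "additive_subgroup_of_vectors (perA \<tau> ` vecs \<int>)"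
proof
  show "0 \<in> perA \<tau> ` vecs \<int>" by (rule image_eqI [of _ _ 0]) auto
qed (auto simp: image_iff, metis perA_simps(1) vecs_Ints_simps(1), metis perA_simps(3) vecs_Ints_simps(3))

lemma additive_subgroup_perB: "additive_subgroup_of_vectors (perB \<tau> ` vecs \<int>)"
proof
  show "0 \<in> perB \<tau> ` vecs \<int>" by (rule image_eqI [of _ _ 0]) auto
qed (auto simp: image_iff, metis perB_simps(1) vecs_Ints_simps(1), metis perB_simps(3) vecs_Ints_simps(3))

lemma additive_subgroup_two_pi_i: "additive_subgroup_of_vectors (range (\<lambda>k::int. two_pi_i * of_int k))"
proof
  show "0 \<in> range (\<lambda>k::int. two_pi_i * of_int k)" by (rule image_eqI [of _ _ 0]) auto
  show "a + b \<in> range (\<lambda>k::int. two_pi_i * of_int k)"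
    if "a \<in> range (\<lambda>k::int. two_pi_i * of_int k)" "b \<in> range (\<lambda>k::int. two_pi_i * of_int k)" for a b
    using that by (auto simp: distrib_left [symmetric] simp flip: of_int_add simp del: mult_cancel_left)
  show "- a \<in> range (\<lambda>k::int. two_pi_i * of_int k)"
    if "a \<in> range (\<lambda>k::int. two_pi_i * of_int k)" for a
  proof -
    from that obtain k :: int where "a = two_pi_i * of_int k" by blast
    then show ?thesis by (intro image_eqI [of _ _ "- k"]) auto
  qed
qed

lemmas clsA_eq_iff = additive_subgroup_of_vectors.coset_eq_iff [OF additive_subgroup_perA, folded clsA_def]
  and clsA_eq = additive_subgroup_of_vectors.coset_eq [OF additive_subgroup_perA, folded clsA_def]
  and carrier_avA = additive_subgroup_of_vectors.carrier_Mod [OF additive_subgroup_perA, folded clsA_def avA_def]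
  and mult_avA = additive_subgroup_of_vectors.mult_Mod [OF additive_subgroup_perA, folded clsA_def avA_def]
  and inv_avA = additive_subgroup_of_vectors.inv_Mod [OF additive_subgroup_perA, folded clsA_def avA_def]

lemmas clsB_eq_iff = additive_subgroup_of_vectors.coset_eq_iff [OF additive_subgroup_perB, folded clsB_def]
  and clsB_eq = additive_subgroup_of_vectors.coset_eq [OF additive_subgroup_perB, folded clsB_def]
  and carrier_avB = additive_subgroup_of_vectors.carrier_Mod [OF additive_subgroup_perB, folded clsB_def avB_def]
  and mult_avB = additive_subgroup_of_vectors.mult_Mod [OF additive_subgroup_perB, folded clsB_def avB_def]
  and one_avB = additive_subgroup_of_vectors.one_Mod [OF additive_subgroup_perB, folded clsB_def avB_def]
  and comm_group_avB = additive_subgroup_of_vectors.comm_group_Mod [OF additive_subgroup_perB, folded avB_def]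

lemma exp_eq_iff_period: "exp w = exp w' \<longleftrightarrow> (\<exists>z\<in>\<int>. w' = w + two_pi_i * z)"
proof -
  have "exp w = exp w' \<longleftrightarrow> exp w' = exp w" by auto
  also have "\<dots> \<longleftrightarrow> (\<exists>n::int. w' = w + (of_int (2 * n) * pi) * \<i>)"
    by (rule exp_eq)
  also have "\<dots> \<longleftrightarrow> (\<exists>z\<in>\<int>. w' = w + two_pi_i * z)"
    by (auto simp: Ints_def mult_ac)
  finally show ?thesis .
qed

section \<open>Orbits of the integral unipotent group\<close>

lemma Pu_Ints_mult: "p \<in> Pu \<int> \<Longrightarrow> q \<in> Pu \<int> \<Longrightarrow> p ** q \<in> Pu \<int>"
  unfolding Pu_def
  by (clarsimp simp: block_mult_block block_eq_iff dotc_Ints)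

lemma Pu_Ints_inverse:
  assumes "p \<in> Pu \<int>"
  shows "\<exists>q\<in>Pu \<int>. q ** p = mat 1 \<and> p ** q = mat 1"
proof -
  from assms obtain x y z where p: "p = block 1 (mat 1) x y z" and i: "x \<in> vecs \<int>" "y \<in> vecs \<int>" "z \<in> \<int>"
    by (auto simp: Pu_def)
  \<comment> \<open>The corner entry offsets the term \<open>- dotc x y\<close> that both products
    put into the corner.\<close>
  let ?q = "block 1 (mat 1) (- x) (- y) (dotc x y - z)"
  have "?q \<in> Pu \<int>" unfolding Pu_def using i by (fastforce intro: dotc_Ints)
  moreover have "?q ** p = mat 1" "p ** ?q = mat 1"
    by (simp_all add: p block_mult_block flip: block_1)
  ultimately show ?thesis by blast
qed

lemma orbit_Pu_shift:
  assumes "p \<in> Pu \<int>" and "\<And>q r F. \<psi> q (\<psi> r F) = \<psi> (q ** r) F"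
  shows "orbit (mat_monoid (Pu \<int>)) \<psi> (\<psi> p F) = orbit (mat_monoid (Pu \<int>)) \<psi> F"
proof -
  obtain q where q: "q \<in> Pu \<int>" "q ** p = mat 1"
    using Pu_Ints_inverse [OF assms(1)] by blast
  have "\<exists>r'. \<psi> r (\<psi> p F) = \<psi> r' F \<and> r' \<in> Pu \<int>" if "r \<in> Pu \<int>" for r
    using assms that by (intro exI [of _ "r ** p"]) (simp add: Pu_Ints_mult)
  moreover have "\<exists>r'. \<psi> r F = \<psi> r' (\<psi> p F) \<and> r' \<in> Pu \<int>" if "r \<in> Pu \<int>" for r
  proof (intro exI [of _ "r ** q"] conjI)
    show "\<psi> r F = \<psi> (r ** q) (\<psi> p F)"
      by (simp add: assms(2) q(2) flip: matrix_mul_assoc)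
  qed (use that q in \<open>simp add: Pu_Ints_mult\<close>)
  ultimately show ?thesis
    unfolding orbit_def mat_monoid_def by auto
qed

lemma pt_eq: "pt \<tau> u v w =
   {F0 \<tau> (u + perB \<tau> x) (v + perA \<tau> y)
      (w + two_pi_i * (z + dotc (upper x) v) - dotc (u + perB \<tau> x) (lower y)) | x y z.
      x \<in> vecs \<int> \<and> y \<in> vecs \<int> \<and> z \<in> \<int>}"
  unfolding pt_def orbit_def mat_monoid_def Pu_def
proof (rule Set.set_eqI, rule iffI)
  fix F
  assume "F \<in> {act g (F0 \<tau> u v w) |g. g \<in> carrier \<lparr>carrier = {block 1 (mat 1) x y z |x y z.
       x \<in> vecs \<int> \<and> y \<in> vecs \<int> \<and> z \<in> \<int>}, mult = (**), one = mat 1\<rparr>}"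
  then obtain x y z where "x \<in> vecs \<int>" "y \<in> vecs \<int>" "z \<in> \<int>" "F = act (block 1 (mat 1) x y z) (F0 \<tau> u v w)"
    by auto
  then show "F \<in> {F0 \<tau> (u + perB \<tau> x) (v + perA \<tau> y)
      (w + two_pi_i * (z + dotc (upper x) v) - dotc (u + perB \<tau> x) (lower y)) | x y z.
      x \<in> vecs \<int> \<and> y \<in> vecs \<int> \<and> z \<in> \<int>}"
    unfolding act_F0 by blast
next
  fix F
  assume "F \<in> {F0 \<tau> (u + perB \<tau> x) (v + perA \<tau> y)
      (w + two_pi_i * (z + dotc (upper x) v) - dotc (u + perB \<tau> x) (lower y)) | x y z.
      x \<in> vecs \<int> \<and> y \<in> vecs \<int> \<and> z \<in> \<int>}"
  then obtain x y z where xyz: "x \<in> vecs \<int>" "y \<in> vecs \<int>" "z \<in> \<int>" and F: "F = act (block 1 (mat 1) x y z) (F0 \<tau> u v w)"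
    unfolding act_F0 by blast
  show "F \<in> {act g (F0 \<tau> u v w) |g. g \<in> carrier \<lparr>carrier = {block 1 (mat 1) x y z |x y z.
       x \<in> vecs \<int> \<and> y \<in> vecs \<int> \<and> z \<in> \<int>}, mult = (**), one = mat 1\<rparr>}"
    unfolding F using xyz by auto
qed

lemma F0_mem_pt_iff: "F0 \<tau> u' v' w' \<in> pt \<tau> u v w \<longleftrightarrow>
    (\<exists>x y z. x \<in> vecs \<int> \<and> y \<in> vecs \<int> \<and> z \<in> \<int> \<and> u' = u + perB \<tau> x \<and> v' = v + perA \<tau> y \<and>
      w' = w + two_pi_i * (z + dotc (upper x) v) - dotc (u + perB \<tau> x) (lower y))"
  unfolding pt_eq mem_Collect_eq F0_inj by blast

lemma F0_mem_ptI:
  assumes "x \<in> vecs \<int>" "y \<in> vecs \<int>" "z \<in> \<int>" "u' = u + perB \<tau> x" "v' = v + perA \<tau> y"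
    "w' = w + two_pi_i * (z + dotc (upper x) v) - dotc (u + perB \<tau> x) (lower y)"
  shows "F0 \<tau> u' v' w' \<in> pt \<tau> u v w"
  using assms unfolding F0_mem_pt_iff by blast

lemma pt_memE:
  assumes "F \<in> pt \<tau> u v w"
  obtains x y z where "x \<in> vecs \<int>" "y \<in> vecs \<int>" "z \<in> \<int>" "F = F0 \<tau> (u + perB \<tau> x) (v + perA \<tau> y)
      (w + two_pi_i * (z + dotc (upper x) v) - dotc (u + perB \<tau> x) (lower y))"
  using assms unfolding pt_eq by blast

lemma F0_mem_pt: "F0 \<tau> u v w \<in> pt \<tau> u v w"
  unfolding pt_eq by (rule CollectI, rule exI [of _ 0], rule exI [of _ 0], rule exI [of _ 0]) simp

lemma pt_shift:
  assumes "x \<in> vecs \<int>" "y \<in> vecs \<int>" "z \<in> \<int>"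
  shows "pt \<tau> (u + perB \<tau> x) (v + perA \<tau> y)
    (w + two_pi_i * (z + dotc (upper x) v) - dotc (u + perB \<tau> x) (lower y)) = pt \<tau> u v w"
proof -
  have "block 1 (mat 1) x y z \<in> Pu \<int>"
    using assms by (auto simp: Pu_def)
  from orbit_Pu_shift [OF this, of act "F0 \<tau> u v w"] show ?thesis
    by (simp add: pt_def act_act act_F0)
qed

lemma pt_eq_iff: "pt \<tau> u' v' w' = pt \<tau> u v w \<longleftrightarrow> F0 \<tau> u' v' w' \<in> pt \<tau> u v w"
proof
  assume "F0 \<tau> u' v' w' \<in> pt \<tau> u v w"
  then show "pt \<tau> u' v' w' = pt \<tau> u v w"
    unfolding F0_mem_pt_iff using pt_shift by blast
qed (metis F0_mem_pt)

text \<open>In this form and that of \<open>pt_shift_v\<close> the translations become factors of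
  automorphy: a period in \<open>u\<close> or in \<open>v\<close> is traded for a change of
  \<open>w\<close>.\<close>

lemma pt_shift_u: "n \<in> vecs \<int> \<Longrightarrow>
    pt \<tau> (u + perB \<tau> n) v w = pt \<tau> u v (w - two_pi_i * dotc (upper n) v)"
  using pt_shift [of n 0 0 \<tau> u v "w - two_pi_i * dotc (upper n) v"] by simp

lemma pt_shift_v: "y \<in> vecs \<int> \<Longrightarrow>
    pt \<tau> u (v + perA \<tau> y) w = pt \<tau> u v (w + dotc u (lower y))"
  using pt_shift [of 0 y 0 \<tau> u v "w + dotc u (lower y)"] by simp

lemma perA_Ints_eq_0: "\<tau> \<in> siegel \<Longrightarrow> y \<in> vecs \<int> \<Longrightarrow> perA \<tau> y = 0 \<longleftrightarrow> y = 0"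
  and perB_Ints_eq_0: "\<tau> \<in> siegel \<Longrightarrow> x \<in> vecs \<int> \<Longrightarrow> perB \<tau> x = 0 \<longleftrightarrow> x = 0"
  by (auto simp: vecs_Ints_complex dest: perA_cvec_eq_0 perB_cvec_eq_0)

lemma perB_Ints_inj: "\<tau> \<in> siegel \<Longrightarrow> x \<in> vecs \<int> \<Longrightarrow> x' \<in> vecs \<int> \<Longrightarrow> perB \<tau> x = perB \<tau> x' \<longleftrightarrow> x = x'"
  using perB_Ints_eq_0 [of \<tau> "x - x'"] by auto

text \<open>For \<open>\<tau>\<close> in the Siegel space, an integral translation that fixes
  \<open>u\<close> and \<open>v\<close> has \<open>x = 0\<close> and \<open>y = 0\<close>, so it
  only adds an integer multiple of \<open>two_pi_i\<close> to \<open>w\<close>. This makes the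
  fibres torsors under the nonzero complex numbers.\<close>

lemma pt_eq_exp_iff:
  assumes "\<tau> \<in> siegel"
  shows "pt \<tau> u v w = pt \<tau> u v w' \<longleftrightarrow> exp w = exp w'"
proof -
  have "pt \<tau> u v w = pt \<tau> u v w' \<longleftrightarrow> F0 \<tau> u v w \<in> pt \<tau> u v w'"
    by (rule pt_eq_iff)
  also have "\<dots> \<longleftrightarrow> (\<exists>z\<in>\<int>. w = w' + two_pi_i * z)"
  proof
    assume "\<exists>z\<in>\<int>. w = w' + two_pi_i * z"
    then obtain z where "z \<in> \<int>" "w = w' + two_pi_i * z" by blast
    then show "F0 \<tau> u v w \<in> pt \<tau> u v w'"
      by (intro F0_mem_ptI [of 0 0 z]) simp_all
  qed (auto simp: F0_mem_pt_iff perA_Ints_eq_0 [OF assms] perB_Ints_eq_0 [OF assms] simp del: mult_eq_0_iff)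
  also have "\<dots> \<longleftrightarrow> exp w = exp w'"
    by (metis exp_eq_iff_period)
  finally show ?thesis .
qed

section \<open>Fibres of the torsor, its scalar action and addition over \<open>B\<close>\<close>

lemma projA_pt: "projA \<tau> (pt \<tau> u v w) = clsA \<tau> v"
  unfolding projA_def clsA_eq pt_eq by (auto simp: add.commute simp del: mult_eq_0_iff) (metis vecs_Ints_simps(4) Ints_0)

lemma projB_pt: "projB \<tau> (pt \<tau> u v w) = clsB \<tau> u"
  unfolding projB_def clsB_eq pt_eq by (auto simp: add.commute simp del: mult_eq_0_iff) (metis vecs_Ints_simps(4) Ints_0)

lemma poincare_eq: "poincare \<tau> = {pt \<tau> u v w | u v w. True}"
  unfolding poincare_def orbits_def D_fibre_def pt_def by auto

lemma ext_carrier: "{e \<in> poincare \<tau>. projB \<tau> e = clsB \<tau> u} = {pt \<tau> u v w | v w. True}"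
proof (rule Set.set_eqI, rule iffI)
  fix e assume e: "e \<in> {e \<in> poincare \<tau>. projB \<tau> e = clsB \<tau> u}"
  then obtain u' v w where e: "e = pt \<tau> u' v w" and cl: "clsB \<tau> u' = clsB \<tau> u"
    unfolding poincare_eq by (auto simp: projB_pt)
  then obtain n where "n \<in> vecs \<int>" "u' - u = perB \<tau> n"
    by (auto simp: clsB_eq_iff)
  then have "e = pt \<tau> u v (w - two_pi_i * dotc (upper n) v)"
    unfolding e using pt_shift_u [of n \<tau> u v w] by (simp add: algebra_simps del: mult_eq_0_iff)
  then show "e \<in> {pt \<tau> u v w | v w. True}" by blast
qed (auto simp: projB_pt poincare_eq)

lemma poincare_fibre_eq: "poincare_fibre \<tau> (clsA \<tau> v) (clsB \<tau> u) = range (pt \<tau> u v)"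
proof (rule Set.set_eqI, rule iffI)
  fix e assume e: "e \<in> poincare_fibre \<tau> (clsA \<tau> v) (clsB \<tau> u)"
  then obtain v' w where e: "e = pt \<tau> u v' w" and cl: "clsA \<tau> v' = clsA \<tau> v"
    using set_eq_iff [THEN iffD1, OF ext_carrier [of \<tau> u], rule_format, of e]
    by (auto simp: poincare_fibre_def projA_pt)
  then obtain y where "y \<in> vecs \<int>" "v' - v = perA \<tau> y"
    by (auto simp: clsA_eq_iff)
  then have "e = pt \<tau> u v (w + dotc u (lower y))"
    unfolding e using pt_shift_v [of y \<tau> u v w] by (simp add: algebra_simps)
  then show "e \<in> range (pt \<tau> u v)" by blast
qed (auto simp: projB_pt projA_pt poincare_eq poincare_fibre_def)

text \<open>Two logarithms of \<open>t\<close> differ by an integer multiple of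
  \<open>two_pi_i\<close>, which the integer \<open>z\<close> of a translation absorbs; so any
  choice of \<open>s\<close> gives the same orbit.\<close>

lemma torsor_act_pt:
  assumes "exp s = t"
  shows "torsor_act \<tau> t (pt \<tau> u v w) = pt \<tau> u v (w + s)"
proof (rule Set.set_eqI, rule iffI)
  fix F assume "F \<in> torsor_act \<tau> t (pt \<tau> u v w)"
  then obtain u' v' w' s' where F: "F = F0 \<tau> u' v' (w' + s')" "F0 \<tau> u' v' w' \<in> pt \<tau> u v w" "exp s' = t"
    by (auto simp: torsor_act_def)
  then obtain k where "k \<in> \<int>" "s' = s + two_pi_i * k"
    using assms exp_eq_iff_period by metis
  moreover obtain x y z where "x \<in> vecs \<int>" "y \<in> vecs \<int>" "z \<in> \<int>" "u' = u + perB \<tau> x"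
    "v' = v + perA \<tau> y" "w' = w + two_pi_i * (z + dotc (upper x) v) - dotc (u + perB \<tau> x) (lower y)"
    using F(2) unfolding F0_mem_pt_iff by blast
  ultimately show "F \<in> pt \<tau> u v (w + s)"
    unfolding F(1)
    by (intro F0_mem_ptI [of x y "z + k"]) (simp_all add: algebra_simps)
next
  fix F assume "F \<in> pt \<tau> u v (w + s)"
  then obtain x y z where xyz: "x \<in> vecs \<int>" "y \<in> vecs \<int>" "z \<in> \<int>" and F: "F = F0 \<tau> (u + perB \<tau> x) (v + perA \<tau> y)
      (w + s + two_pi_i * (z + dotc (upper x) v) - dotc (u + perB \<tau> x) (lower y))"
    by (rule pt_memE)
  show "F \<in> torsor_act \<tau> t (pt \<tau> u v w)"
    unfolding torsor_act_def F
  proof (intro CollectI exI conjI)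
    show "F0 \<tau> (u + perB \<tau> x) (v + perA \<tau> y)
      (w + two_pi_i * (z + dotc (upper x) v) - dotc (u + perB \<tau> x) (lower y)) \<in> pt \<tau> u v w"
      using xyz unfolding F0_mem_pt_iff by blast
    show "exp s = t" by fact
  qed (simp add: algebra_simps)
qed

text \<open>Representatives that can be added share their first coordinate. As a period has only one
  integral preimage under \<open>perB\<close>, both come from translations with the same
  \<open>x\<close>, and these combine to the translation with \<open>y + y'\<close> and
  \<open>z + z'\<close>.\<close>

lemma add_over_B_pt:
  assumes "\<tau> \<in> siegel"
  shows "add_over_B \<tau> (pt \<tau> u v w) (pt \<tau> u v' w') = pt \<tau> u (v + v') (w + w')"
proof (rule Set.set_eqI, rule iffI)
  fix F assume "F \<in> add_over_B \<tau> (pt \<tau> u v w) (pt \<tau> u v' w')"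
  then obtain u1 v1 v1' w1 w1' where F: "F = F0 \<tau> u1 (v1 + v1') (w1 + w1')"
    and m: "F0 \<tau> u1 v1 w1 \<in> pt \<tau> u v w" "F0 \<tau> u1 v1' w1' \<in> pt \<tau> u v' w'"
    by (auto simp: add_over_B_def)
  obtain x y z where 1: "x \<in> vecs \<int>" "y \<in> vecs \<int>" "z \<in> \<int>" "u1 = u + perB \<tau> x"
    "v1 = v + perA \<tau> y" "w1 = w + two_pi_i * (z + dotc (upper x) v) - dotc (u + perB \<tau> x) (lower y)"
    using m(1) unfolding F0_mem_pt_iff by blast
  obtain x' y' z' where 2: "x' \<in> vecs \<int>" "y' \<in> vecs \<int>" "z' \<in> \<int>" "u1 = u + perB \<tau> x'"
    "v1' = v' + perA \<tau> y'" "w1' = w' + two_pi_i * (z' + dotc (upper x') v') - dotc (u + perB \<tau> x') (lower y')"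
    using m(2) unfolding F0_mem_pt_iff by blast
  have "x' = x" using 1 2 perB_Ints_inj [OF assms] by simp
  then show "F \<in> pt \<tau> u (v + v') (w + w')"
    unfolding F 1(4-6) 2(5,6) using 1(1-3) 2(1-3)
    by (intro F0_mem_ptI [of x "y + y'" "z + z'"]) (simp_all add: algebra_simps)
next
  fix F assume "F \<in> pt \<tau> u (v + v') (w + w')"
  then obtain x y z where xyz: "x \<in> vecs \<int>" "y \<in> vecs \<int>" "z \<in> \<int>" and F: "F = F0 \<tau> (u + perB \<tau> x) (v + v' + perA \<tau> y)
      (w + w' + two_pi_i * (z + dotc (upper x) (v + v')) - dotc (u + perB \<tau> x) (lower y))"
    by (rule pt_memE)
  show "F \<in> add_over_B \<tau> (pt \<tau> u v w) (pt \<tau> u v' w')"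
    unfolding add_over_B_def F
  proof (intro CollectI exI conjI)
    show "F0 \<tau> (u + perB \<tau> x) (v + perA \<tau> y)
      (w + two_pi_i * (z + dotc (upper x) v) - dotc (u + perB \<tau> x) (lower y)) \<in> pt \<tau> u v w"
      using xyz unfolding F0_mem_pt_iff by blast
    \<comment> \<open>The first summand has taken all of \<open>y\<close> and \<open>z\<close>, so
      the second is translated by \<open>x\<close> alone.\<close>
    have "F0 \<tau> (u + perB \<tau> x) (v' + perA \<tau> 0)
      (w' + two_pi_i * (0 + dotc (upper x) v') - dotc (u + perB \<tau> x) (lower 0)) \<in> pt \<tau> u v' w'"
      using xyz Ints_0 vecs_Ints_simps(4) unfolding F0_mem_pt_iff by blast
    then show "F0 \<tau> (u + perB \<tau> x) v' (w' + two_pi_i * dotc (upper x) v') \<in> pt \<tau> u v' w'"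
      by simp
  qed (simp add: algebra_simps)
qed

section \<open>The extension of \<open>A\<close> attached to a point of \<open>B\<close>\<close>

lemma carrier_ext_group: "carrier (ext_group \<tau> (clsB \<tau> u)) = {pt \<tau> u v w | v w. True}"
  by (simp add: ext_group_def ext_carrier Let_def)

lemma mult_ext_group: "\<tau> \<in> siegel \<Longrightarrow>
   pt \<tau> u v w \<otimes>\<^bsub>ext_group \<tau> (clsB \<tau> u)\<^esub> pt \<tau> u v' w' = pt \<tau> u (v + v') (w + w')"
  by (simp add: ext_group_def Let_def add_over_B_pt)

lemma one_ext_group:
  assumes "\<tau> \<in> siegel"
  shows "\<one>\<^bsub>ext_group \<tau> (clsB \<tau> u)\<^esub> = pt \<tau> u 0 0"
proof -
  have "(THE e. e \<in> {pt \<tau> u v w | v w. True} \<and> (\<forall>e'\<in>{pt \<tau> u v w | v w. True}. add_over_B \<tau> e e' = e')) = pt \<tau> u 0 0"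
  proof (rule the_equality)
    fix e assume e: "e \<in> {pt \<tau> u v w | v w. True} \<and> (\<forall>e'\<in>{pt \<tau> u v w | v w. True}. add_over_B \<tau> e e' = e')"
    then obtain v w where "e = pt \<tau> u v w" by blast
    moreover have "add_over_B \<tau> e (pt \<tau> u 0 0) = pt \<tau> u 0 0" using e by blast
    ultimately show "e = pt \<tau> u 0 0" using add_over_B_pt [OF assms, of u v w 0 0] by simp
  next
    show "pt \<tau> u 0 0 \<in> {pt \<tau> u v w | v w. True} \<and> (\<forall>e'\<in>{pt \<tau> u v w | v w. True}. add_over_B \<tau> (pt \<tau> u 0 0) e' = e')"
      using add_over_B_pt [OF assms, of u 0 0] by auto
  qed
  then show ?thesis by (simp add: ext_group_def ext_carrier Let_def)
qed

lemma pow_ext_group: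
  assumes "\<tau> \<in> siegel"
  shows "pt \<tau> u v w [^]\<^bsub>ext_group \<tau> (clsB \<tau> u)\<^esub> (k::nat) = pt \<tau> u (of_nat k *s v) (of_nat k * w)"
proof (induction k)
  case (Suc k)
  then show ?case
    using mult_ext_group [OF assms, of u "of_nat k *s v" "of_nat k * w" v w]
    by (simp add: nat_pow_def algebra_simps vector_sadd_rdistrib)
qed (simp add: nat_pow_def one_ext_group [OF assms])

lemma pow_avB: "clsB \<tau> u [^]\<^bsub>avB \<tau>\<^esub> (k::nat) = clsB \<tau> (of_nat k *s u)"
proof (induction k)
  case (Suc k)
  then show ?case
    using mult_avB [of \<tau> "of_nat k *s u" u]
    by (simp add: nat_pow_def algebra_simps vector_sadd_rdistrib)
qed (simp add: nat_pow_def one_avB)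

section \<open>Entire functions on the tangent space\<close>

lemma holo_funI_linear:
  fixes g :: "complex ^ 'm::finite \<Rightarrow> complex"
  assumes "\<And>a b. g (a + b) = g a + g b" and "\<And>c h. g (c *s h) = c * g h"
  shows "holo_fun S g"
proof -
  have "linear g"
    by (rule linearI) (simp_all add: assms scaleR_complex_vec scaleR_conv_of_real)
  then have "(g has_derivative g) (at x)" for x
    by (simp add: linear_conv_bounded_linear bounded_linear_imp_has_derivative)
  then show ?thesis unfolding holo_fun_def using assms(2) by blast
qed

lemma holo_fun_const: "holo_fun S (\<lambda>x. k)"
  unfolding holo_fun_def by (intro ballI exI [of _ "\<lambda>h. 0"]) auto

lemma holo_fun_add: "holo_fun S f \<Longrightarrow> holo_fun S g \<Longrightarrow> holo_fun S (\<lambda>x. f x + g x)"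
  unfolding holo_fun_def
proof (intro ballI)
  fix x assume "\<forall>x\<in>S. \<exists>L. (f has_derivative L) (at x) \<and> (\<forall>c h. L (c *s h) = c * L h)"
    "\<forall>x\<in>S. \<exists>L. (g has_derivative L) (at x) \<and> (\<forall>c h. L (c *s h) = c * L h)" "x \<in> S"
  then obtain K L where "(f has_derivative K) (at x)" "\<forall>c h. K (c *s h) = c * K h"
    "(g has_derivative L) (at x)" "\<forall>c h. L (c *s h) = c * L h" by blast
  then show "\<exists>L. ((\<lambda>x. f x + g x) has_derivative L) (at x) \<and> (\<forall>c h. L (c *s h) = c * L h)"
    by (intro exI [of _ "\<lambda>h. K h + L h"]) (auto intro: has_derivative_add simp: distrib_left)
qed

lemma holo_fun_cmult: "holo_fun S f \<Longrightarrow> holo_fun S (\<lambda>x. k * f x)"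
  unfolding holo_fun_def
proof (intro ballI)
  fix x assume "\<forall>x\<in>S. \<exists>L. (f has_derivative L) (at x) \<and> (\<forall>c h. L (c *s h) = c * L h)" "x \<in> S"
  then obtain K where "(f has_derivative K) (at x)" "\<forall>c h. K (c *s h) = c * K h" by blast
  then show "\<exists>L. ((\<lambda>x. k * f x) has_derivative L) (at x) \<and> (\<forall>c h. L (c *s h) = c * L h)"
    by (intro exI [of _ "\<lambda>h. k * K h"]) (auto intro: has_derivative_mult_right)
qed

lemma holo_fun_diff: "holo_fun S f \<Longrightarrow> holo_fun S g \<Longrightarrow> holo_fun S (\<lambda>x. f x - g x)"
  using holo_fun_add [OF _ holo_fun_cmult [of S g "-1"], of f] by simp

lemma holo_fun_exp:
  assumes "holo_fun S f" shows "holo_fun S (\<lambda>x. exp (f x))"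
  unfolding holo_fun_def
proof (intro ballI)
  fix x assume "x \<in> S"
  then obtain K where K: "(f has_derivative K) (at x)" "\<forall>c h. K (c *s h) = c * K h"
    using assms unfolding holo_fun_def by blast
  have "(exp has_derivative (*) (exp (f x))) (at (f x))"
    using DERIV_exp [of "f x"] by (simp add: has_field_derivative_def)
  from has_derivative_compose [OF K(1) this]
  show "\<exists>L. ((\<lambda>x. exp (f x)) has_derivative L) (at x) \<and> (\<forall>c h. L (c *s h) = c * L h)"
    using K(2) by (intro exI [of _ "\<lambda>h. exp (f x) * K h"]) auto
qed

lemma holo_fun_subset: "holo_fun S f \<Longrightarrow> T \<subseteq> S \<Longrightarrow> holo_fun T f"
  unfolding holo_fun_def by blast

lemma holo_fun_local:
  assumes "\<And>p. \<exists>N h. open N \<and> p \<in> N \<and> holo_fun N h \<and> (\<forall>q\<in>N. \<delta> q = h q)"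
  shows "holo_fun UNIV \<delta>"
  unfolding holo_fun_def
proof (intro ballI)
  fix p
  obtain N h where N: "open N" "p \<in> N" and h: "holo_fun N h" "\<forall>q\<in>N. \<delta> q = h q"
    using assms by blast
  then obtain L where L: "(h has_derivative L) (at p)" "\<forall>c k. L (c *s k) = c * L k"
    unfolding holo_fun_def by blast
  have "(\<delta> has_derivative L) (at p)"
    by (rule has_derivative_transform_within_open [OF L(1) N]) (use h(2) in simp)
  with L(2) show "\<exists>L. (\<delta> has_derivative L) (at p) \<and> (\<forall>c h. L (c *s h) = c * L h)" by blast
qed

lemma holo_fun_continuous_on: "holo_fun S f \<Longrightarrow> continuous_on S f"
  unfolding holo_fun_def
  by (meson continuous_at_imp_continuous_on has_derivative_continuous)

lemma holo_map_continuous_on: "holo_map S f \<Longrightarrow> continuous_on S f"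
proof -
  assume "holo_map S f"
  then have "continuous_on S (\<lambda>x. \<chi> i. f x $ i)"
    unfolding holo_map_def by (intro continuous_on_vec_lambda holo_fun_continuous_on) blast
  then show ?thesis by simp
qed

lemma holo_fun_dotc: "holo_fun S (\<lambda>q. dotc (q :: complex ^ 'm::finite) k)"
  by (rule holo_funI_linear) auto

text \<open>Restricted to the complex line through a point, such a function is bounded and entire.\<close>

lemma entire_norm_periodic_const:
  assumes \<tau>: "\<tau> \<in> siegel" and holo: "holo_fun UNIV \<delta>"
    and per: "\<And>q n. n \<in> vecs \<int> \<Longrightarrow> norm (\<delta> (q + perB \<tau> n)) = norm (\<delta> q)"
  shows "\<delta> q = \<delta> 0"
proof -
  let ?h = "\<lambda>x. perB \<tau> (cvec x)"
  have "continuous_on UNIV (\<lambda>x. \<delta> (?h x))"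
    by (rule continuous_on_compose2 [OF holo_fun_continuous_on [OF holo]])
      (auto intro: linear_continuous_on simp: linear_perB_cvec simp flip: linear_conv_bounded_linear)
  \<comment> \<open>The unit cube in real coordinates meets every class modulo periods, so a bound
    on it is a global bound.\<close>
  then have "compact ((\<lambda>x. \<delta> (?h x)) ` cbox 0 1)"
    by (meson compact_cbox compact_continuous_image continuous_on_subset subset_UNIV)
  then obtain B where B: "\<forall>x\<in>cbox 0 1. norm (\<delta> (?h x)) \<le> B"
    by (auto dest!: compact_imp_bounded simp: bounded_iff)
  have bound: "norm (\<delta> p) \<le> B" for p
  proof -
    obtain x where x: "p = ?h x" using perB_real_ex [OF \<tau>] by blast
    define n :: "real ^ ('a + 'a)" where "n = (\<chi> i. of_int \<lfloor>x $ i\<rfloor>)"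
    define r where "r = (\<chi> i. frac (x $ i))"
    have "x = r + n" by (simp add: n_def r_def vec_eq_iff frac_def)
    then have "p = ?h r + perB \<tau> (cvec n)" by (simp add: x)
    moreover have "n \<in> vecs \<int>" by (auto simp: n_def vecs_def)
    then have "cvec n \<in> vecs \<int>" by simp
    ultimately have "norm (\<delta> p) = norm (\<delta> (?h r))" by (simp add: per)
    also have "\<dots> \<le> B"
      by (rule bspec [OF B]) (auto simp: mem_box_cart r_def frac_lt_1 less_imp_le)
    finally show ?thesis .
  qed
  let ?g = "\<lambda>z. \<delta> (z *s q)"
  \<comment> \<open>Complex linearity of the derivative \<open>L\<close> of \<open>\<delta>\<close>
    makes the derivative of \<open>?g\<close> multiplication by \<open>L q\<close>.\<close>
  have "?g field_differentiable at z" for z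
  proof -
    obtain L where L: "(\<delta> has_derivative L) (at (z *s q))" "\<forall>c h. L (c *s h) = c * L h"
      using holo unfolding holo_fun_def by blast
    have "((\<lambda>z. z *s q) has_derivative (\<lambda>z. z *s q)) (at z)"
    proof (rule bounded_linear_imp_has_derivative)
      have "linear (\<lambda>z. z *s q)"
        by (rule linearI) (simp_all add: vec_eq_iff algebra_simps)
      then show "bounded_linear (\<lambda>z. z *s q)" by (simp add: linear_conv_bounded_linear)
    qed
    from has_derivative_compose [OF this L(1)] L(2)
    have "(?g has_derivative (\<lambda>c. L q * c)) (at z)" by (simp add: mult.commute)
    then show ?thesis
      by (auto simp: field_differentiable_def has_field_derivative_def)
  qed
  then have "?g holomorphic_on UNIV"
    by (simp add: holomorphic_on_def)
  moreover have "bounded (range ?g)"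
    using bound by (auto simp: bounded_iff)
  ultimately have "?g constant_on UNIV" by (rule Liouville_theorem)
  then have "?g 1 = ?g 0" unfolding constant_on_def by (metis UNIV_I)
  then show ?thesis by simp
qed

text \<open>The real coordinates \<open>k\<close> of \<open>v\<close> are continuous and integral,
  and integers at distance less than 1 agree. It compares two local lifts of one map into
  \<open>A\<close>, which differ by periods.\<close>

lemma perA_Ints_locally_const:
  assumes \<tau>: "\<tau> \<in> siegel" and N: "open N" "p \<in> N" and v: "continuous_on N v"
    and lat: "\<And>q. q \<in> N \<Longrightarrow> v q \<in> perA \<tau> ` vecs \<int>"
  shows "\<exists>N' y. open N' \<and> p \<in> N' \<and> N' \<subseteq> N \<and> y \<in> vecs \<int> \<and> (\<forall>q\<in>N'. v q = perA \<tau> y)"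
proof -
  let ?h = "\<lambda>y. perA \<tau> (cvec y)"
  define k where "k q = inv_into UNIV ?h (v q)" for q
  have hk: "?h (k q) = v q" for q
    unfolding k_def using bij_is_surj [OF perA_cvec_iso(1) [OF \<tau>]] by (rule surj_f_inv_f)
  have kint: "k q \<in> vecs \<int>" if q: "q \<in> N" for q
  proof -
    obtain y where "y \<in> vecs \<int>" "v q = perA \<tau> (cvec y)"
      using lat [OF q] by (auto simp: vecs_Ints_complex)
    then show ?thesis using hk [of q] by (simp add: perA_real_inj [OF \<tau>])
  qed
  have cont: "continuous_on N k"
    unfolding k_def
    by (rule continuous_on_compose2 [OF linear_continuous_on [OF perA_cvec_iso(2) [OF \<tau>]] v]) auto
  have "open (N \<inter> k -` ball (k p) 1)"
    using continuous_on_open_vimage [OF N(1)] cont by (metis inf_commute open_ball)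
  moreover have "k q = k p" if q: "q \<in> N \<inter> k -` ball (k p) 1" for q
  proof -
    have "k q $ i = k p $ i" for i
    proof -
      have "\<bar>k q $ i - k p $ i\<bar> \<le> norm (k q - k p)"
        by (metis component_le_norm_cart vector_minus_component)
      also have "\<dots> < 1" using q by (auto simp: dist_norm norm_minus_commute)
      finally have lt: "\<bar>k q $ i - k p $ i\<bar> < 1" .
      have "k q $ i \<in> \<int>" "k p $ i \<in> \<int>"
        using kint q N(2) by (auto simp: vecs_def)
      then show ?thesis using lt by (auto elim!: Ints_cases simp flip: of_int_diff)
    qed
    then show ?thesis by (simp add: vec_eq_iff)
  qed
  then have "\<forall>q\<in>N \<inter> k -` ball (k p) 1. v q = perA \<tau> (cvec (k p))"
    using hk by metis
  moreover have "p \<in> N \<inter> k -` ball (k p) 1" using N by simp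
  moreover have "cvec (k p) \<in> vecs \<int>" using kint [OF N(2)] by simp
  ultimately show ?thesis by blast
qed

section \<open>The lattice matrix of the dual morphism\<close>

text \<open>The standard basis consists of integral vectors.\<close>

lemma C_linear_eqI:
  fixes h k :: "complex ^ 'm::finite \<Rightarrow> complex ^ 'n::finite"
  assumes "\<And>a b. h (a + b) = h a + h b" "\<And>c a. h (c *s a) = c *s h a"
    and "\<And>a b. k (a + b) = k a + k b" "\<And>c a. k (c *s a) = c *s k a"
    and "\<And>n. n \<in> vecs \<int> \<Longrightarrow> h n = k n"
  shows "h x = k x"
proof -
  have h0: "h 0 = 0" using assms(2) [of 0 0] by simp
  have k0: "k 0 = 0" using assms(4) [of 0 0] by simp
  have ax: "axis i 1 \<in> (vecs \<int> :: (complex ^ 'm) set)" for i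
    by (auto simp: vecs_def axis_def)
  have sums: "h (\<Sum>i\<in>S. (x $ i) *s axis i 1) = k (\<Sum>i\<in>S. (x $ i) *s axis i 1)" if "finite S" for S
    using that by (induction S rule: finite_induct) (simp_all add: h0 k0 assms(1-4) assms(5) [OF ax])
  show ?thesis
    using sums [of UNIV] by (simp add: basis_expansion)
qed

text \<open>Both sides are complex linear in \<open>x\<close>. The extension allows \<open>x\<close>
  to be real, or to lie in the complex kernel of \<open>perB\<close>.\<close>

lemma lattice_map_extends:
  assumes "\<And>n. n \<in> vecs \<int> \<Longrightarrow> L *v perB \<tau> n = perA \<tau> (map_matrix of_int N *v n)"
  shows "L *v perB \<tau> x = perA \<tau> (map_matrix of_int N *v x)"
  by (rule C_linear_eqI [of "\<lambda>x. L *v perB \<tau> x" "\<lambda>x. perA \<tau> (map_matrix of_int N *v x)"])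
    (simp_all add: assms vec_scale_matrix matrix_vector_right_distrib)

text \<open>The equivariant \<open>\<phi>\<close> supplied by duality is described over each
  \<open>q\<close> by a number \<open>c q\<close>, determined modulo \<open>two_pi_i\<close>.
  Transporting a period through both extensions gives its factor of automorphy. Multiplied by the
  exponential of a linear form, the function has factors of absolute value 1, so it is constant and
  the factors are 1.\<close>

lemma dual_lattice_integrality:
  fixes \<tau> :: "complex ^ 'd::finite ^ 'd" and F H :: "int ^ ('d + 'd) ^ ('d + 'd)"
    and x m :: "real ^ ('d + 'd)"
  assumes \<tau>: "\<tau> \<in> siegel" and dual: "dual_morphism \<tau> f g"
    and f: "\<And>u. f (clsB \<tau> u) = clsA \<tau> (L *v u)"
    and L: "\<And>n. n \<in> vecs \<int> \<Longrightarrow> L *v perB \<tau> n = perA \<tau> (map_matrix of_int F *v n)"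
    and g: "\<And>u. g (clsB \<tau> u) = clsA \<tau> (K *v u)"
    and K: "\<And>n. n \<in> vecs \<int> \<Longrightarrow> K *v perB \<tau> n = perA \<tau> (map_matrix of_int H *v n)"
    and m: "m \<in> vecs \<int>"
  shows "x \<bullet> (map_matrix of_int F *v m) + m \<bullet> (map_matrix of_int H *v x) \<in> \<int>"
proof -
  define FC HC :: "complex ^ ('d + 'd) ^ ('d + 'd)" where "FC = map_matrix of_int F" and "HC = map_matrix of_int H"
  \<comment> \<open>\<open>u\<close> is the tangent vector with real coordinates \<open>x\<close>,
    and \<open>v\<close> lifts the image of its class under \<open>g\<close>, computed with the
    lattice matrix.\<close>
  define u v where "u = perB \<tau> (cvec x)" and "v = perA \<tau> (HC *v cvec x)"
  have LF: "L *v perB \<tau> y = perA \<tau> (FC *v y)" for y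
    unfolding FC_def by (rule lattice_map_extends) (rule L)
  have "g (clsB \<tau> u) = clsA \<tau> v"
    unfolding u_def v_def HC_def g by (simp add: lattice_map_extends [OF K])
  with dual obtain \<phi> where
    \<phi>: "\<forall>b'\<in>carrier (avB \<tau>). \<forall>e\<in>poincare_fibre \<tau> (f b') (clsB \<tau> u).
           \<phi> b' e \<in> poincare_fibre \<tau> (clsA \<tau> v) b' \<and>
           (\<forall>t. t \<noteq> 0 \<longrightarrow> \<phi> b' (torsor_act \<tau> t e) = torsor_act \<tau> t (\<phi> b' e))"
    and loc: "\<forall>p. \<exists>N F h. open N \<and> p \<in> N \<and> holo_map N F \<and> holo_fun N h \<and>
           (\<forall>q\<in>N. f (clsB \<tau> q) = clsA \<tau> (F q) \<and>
              \<phi> (clsB \<tau> q) (pt \<tau> u (F q) 0) = pt \<tau> q v (h q))"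
    unfolding dual_morphism_def by (elim conjE) (drule spec2, drule (1) mp, elim exE conjE, rule that)
  have mem: "pt \<tau> u (L *v q) w \<in> poincare_fibre \<tau> (f (clsB \<tau> q)) (clsB \<tau> u)" for q w
    by (simp add: f poincare_fibre_eq)
  have carr: "clsB \<tau> q \<in> carrier (avB \<tau>)" for q
    by (simp add: carrier_avB)
  have "\<exists>c. \<phi> (clsB \<tau> q) (pt \<tau> u (L *v q) 0) = pt \<tau> q v c" for q
    using bspec [OF bspec [OF \<phi> carr] mem, of q 0] by (auto simp: poincare_fibre_eq)
  \<comment> \<open>The choice is made pointwise, so \<open>c\<close> need not be continuous; only
    \<open>exp (c q)\<close> is determined, and the claims below concern it alone.\<close>
  then obtain c where c: "\<And>q. \<phi> (clsB \<tau> q) (pt \<tau> u (L *v q) 0) = pt \<tau> q v (c q)"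
    by metis
  have cw: "\<phi> (clsB \<tau> q) (pt \<tau> u (L *v q) w) = pt \<tau> q v (c q + w)" for q w
  proof -
    have "pt \<tau> u (L *v q) w = torsor_act \<tau> (exp w) (pt \<tau> u (L *v q) 0)"
      by (simp add: torsor_act_pt)
    then have "\<phi> (clsB \<tau> q) (pt \<tau> u (L *v q) w) = torsor_act \<tau> (exp w) (pt \<tau> q v (c q))"
      using bspec [OF bspec [OF \<phi> carr] mem, of q 0] c [of q] by simp
    then show ?thesis by (simp add: torsor_act_pt)
  qed
  \<comment> \<open>Adding a period to \<open>q\<close> alters the source point by
    \<open>pt_shift_v\<close> and the target point by \<open>pt_shift_u\<close>; comparing the two
    gives the factor.\<close>
  have c_shift: "exp (c (q + perB \<tau> n)) = exp (c q + dotc u (lower (FC *v n)) + two_pi_i * dotc (upper n) v)"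
    if n: "n \<in> vecs \<int>" for q n
  proof -
    have "clsB \<tau> (q + perB \<tau> n) = clsB \<tau> q"
      by (simp add: clsB_eq_iff n)
    moreover have "pt \<tau> u (L *v (q + perB \<tau> n)) 0 = pt \<tau> u (L *v q) (dotc u (lower (FC *v n)))"
      using pt_shift_v [OF of_int_matrix_Ints [OF n], of \<tau> u "L *v q" F 0]
      by (simp add: matrix_vector_right_distrib LF FC_def)
    ultimately have "pt \<tau> (q + perB \<tau> n) v (c (q + perB \<tau> n)) = pt \<tau> q v (c q + dotc u (lower (FC *v n)))"
      using c [of "q + perB \<tau> n"] cw by metis
    then have "exp (c (q + perB \<tau> n) - two_pi_i * dotc (upper n) v) = exp (c q + dotc u (lower (FC *v n)))"
      by (simp only: pt_shift_u [OF n] pt_eq_exp_iff [OF \<tau>])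
    then show ?thesis by (simp add: exp_diff exp_add field_simps)
  qed
  \<comment> \<open>The lift \<open>G\<close>, which is the bound \<open>F\<close> of
    \<open>loc\<close> and not the matrix, differs from the linear lift \<open>L\<close> by a period
    that is constant near \<open>p\<close>; \<open>pt_shift_v\<close> converts it into a constant
    correction of \<open>h\<close>.\<close>
  have c_local: "\<exists>N h. open N \<and> p \<in> N \<and> holo_fun N h \<and> (\<forall>q\<in>N. exp (c q) = exp (h q))" for p
  proof -
    obtain N G h where N: "open N" "p \<in> N" and hol: "holo_map N G" "holo_fun N h"
      and G: "\<And>q. q \<in> N \<Longrightarrow> f (clsB \<tau> q) = clsA \<tau> (G q)"
      and h: "\<And>q. q \<in> N \<Longrightarrow> \<phi> (clsB \<tau> q) (pt \<tau> u (G q) 0) = pt \<tau> q v (h q)"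
      using loc by metis
    have "continuous_on N (\<lambda>q. G q - L *v q)"
      by (intro continuous_on_diff holo_map_continuous_on [OF hol(1)])
        (auto intro!: linear_continuous_on simp flip: linear_conv_bounded_linear)
    moreover have "G q - L *v q \<in> perA \<tau> ` vecs \<int>" if "q \<in> N" for q
      using G [OF that] by (simp add: f clsA_eq_iff [symmetric])
    ultimately obtain N' y where N': "open N'" "p \<in> N'" "N' \<subseteq> N" and y: "y \<in> vecs \<int>"
      "\<forall>q\<in>N'. G q - L *v q = perA \<tau> y"
      using perA_Ints_locally_const [OF \<tau> N, of "\<lambda>q. G q - L *v q"] by blast
    have "exp (c q) = exp (h q - dotc u (lower y))" if q: "q \<in> N'" for q
    proof -
      have "G q = L *v q + perA \<tau> y" using y(2) q by (metis add.commute diff_add_cancel)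
      then have "pt \<tau> u (G q) 0 = pt \<tau> u (L *v q) (dotc u (lower y))"
        using pt_shift_v [OF y(1), of \<tau> u "L *v q" 0] by simp
      then have "pt \<tau> q v (c q + dotc u (lower y)) = pt \<tau> q v (h q)"
        using h [of q] q N'(3) cw [of q] by (metis subsetD)
      then show ?thesis
        by (simp add: pt_eq_exp_iff [OF \<tau>] exp_add exp_diff field_simps)
    qed
    moreover have "holo_fun N' (\<lambda>q. h q - dotc u (lower y))"
      by (intro holo_fun_diff holo_fun_const holo_fun_subset [OF hol(2) N'(3)])
    ultimately show ?thesis using N' by blast
  qed
  \<comment> \<open>By \<open>dotc_period\<close>, the increment of \<open>ell\<close> along
    \<open>perB \<tau> n\<close> supplies the two terms that the exponent in \<open>c_shift\<close>
    lacks to become \<open>two_pi_i\<close> times a pairing that is real on real vectors.\<close>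
  define ell where "ell q = two_pi_i * dotc (upper (cvec x)) (L *v q) + dotc q (lower (HC *v cvec x))" for q
  define \<delta> where "\<delta> q = exp (c q + ell q)" for q
  have "holo_fun UNIV \<delta>"
  proof (rule holo_fun_local)
    fix p
    obtain N h where N: "open N" "p \<in> N" and h: "holo_fun N h" "\<forall>q\<in>N. exp (c q) = exp (h q)"
      using c_local by blast
    have "holo_fun N ell"
      by (rule holo_funI_linear)
        (simp_all add: ell_def matrix_vector_right_distrib vec_scale_matrix algebra_simps)
    then have "holo_fun N (\<lambda>q. exp (h q + ell q))"
      by (intro holo_fun_exp holo_fun_add h(1))
    moreover have "\<forall>q\<in>N. \<delta> q = exp (h q + ell q)"
      using h(2) by (simp add: \<delta>_def exp_add)
    ultimately show "\<exists>N h. open N \<and> p \<in> N \<and> holo_fun N h \<and> (\<forall>q\<in>N. \<delta> q = h q)"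
      using N by blast
  qed
  moreover have shift: "\<delta> (q + perB \<tau> n) =
      \<delta> q * exp (two_pi_i * (dotc (cvec x) (FC *v n) + dotc n (HC *v cvec x)))"
    if n: "n \<in> vecs \<int>" for q n
  proof -
    have "ell (q + perB \<tau> n) = ell q + two_pi_i * dotc (upper (cvec x)) (perA \<tau> (FC *v n))
        + dotc (perB \<tau> n) (lower (HC *v cvec x))"
      by (simp add: ell_def matrix_vector_right_distrib LF distrib_left del: mult_eq_0_iff)
    moreover have "two_pi_i * (dotc (cvec x) (FC *v n) + dotc n (HC *v cvec x)) =
        two_pi_i * dotc (upper (cvec x)) (perA \<tau> (FC *v n)) + dotc u (lower (FC *v n)) +
        (two_pi_i * dotc (upper n) v + dotc (perB \<tau> n) (lower (HC *v cvec x)))"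
      unfolding u_def v_def distrib_left by (simp only: dotc_period [symmetric])
    ultimately show ?thesis
      by (simp only: \<delta>_def exp_add c_shift [OF n] mult_ac)
  qed
  moreover have "norm (\<delta> (q + perB \<tau> n)) = norm (\<delta> q)" if n: "n \<in> vecs \<int>" for q n
  proof -
    obtain n' where n': "n = cvec n'" using n by (auto simp: vecs_Ints_complex)
    show ?thesis
      unfolding shift [OF n]
      by (simp add: norm_mult norm_exp_eq_Re n' FC_def HC_def of_int_matrix_cvec dotc_cvec
          flip: of_real_add)
  qed
  ultimately have "\<delta> (perB \<tau> (cvec m)) = \<delta> 0"
    by (intro entire_norm_periodic_const [OF \<tau>])
  \<comment> \<open>Since \<open>\<delta>\<close> has no zeros, its constancy forces the factor at
    the period of \<open>m\<close> to be 1.\<close>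
  with shift [of "cvec m" 0] m have "exp (two_pi_i * (dotc (cvec x) (FC *v cvec m) + dotc (cvec m) (HC *v cvec x))) = 1"
    by (simp add: \<delta>_def del: mult_eq_0_iff)
  then have "exp 0 = exp (two_pi_i * complex_of_real (x \<bullet> (map_matrix of_int F *v m) + m \<bullet> (map_matrix of_int H *v x)))"
    by (simp add: FC_def HC_def of_int_matrix_cvec dotc_cvec)
  then obtain z where "z \<in> \<int>" "two_pi_i * complex_of_real (x \<bullet> (map_matrix of_int F *v m) + m \<bullet> (map_matrix of_int H *v x)) = 0 + two_pi_i * z"
    unfolding exp_eq_iff_period by blast
  then have "complex_of_real (x \<bullet> (map_matrix of_int F *v m) + m \<bullet> (map_matrix of_int H *v x)) \<in> \<int>"
    by simp
  then show ?thesis by (simp only: complex_of_real_Ints_iff)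
qed

lemma real_multiples_Ints_eq_0:
  assumes "\<And>t :: real. t * of_int k \<in> \<int>"
  shows "k = 0"
proof (rule ccontr)
  assume "k \<noteq> 0"
  then have "1 / (2 * of_int k) * of_int k = (1 / 2 :: real)" by simp
  then have "(1 / 2 :: real) \<in> \<int>" using assms by metis
  then obtain n :: int where "1 / 2 = real_of_int n" by (auto elim: Ints_cases)
  then have "real_of_int 1 = real_of_int (2 * n)" by simp
  then have "1 = 2 * n" by (simp only: of_int_eq_iff)
  then show False by presburger
qed

text \<open>Evaluating the integrality on \<open>x = t *\<^sub>R axis i 1\<close> and
  \<open>m = axis j 1\<close> leaves \<open>t\<close> times the sum of an entry of \<open>F\<close>
  and the transposed entry of \<open>H\<close>; this is integral for all real \<open>t\<close> only
  if the sum vanishes.\<close>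

lemma dual_lattice_matrix:
  fixes \<tau> :: "complex ^ 'd::finite ^ 'd" and F H :: "int ^ ('d + 'd) ^ ('d + 'd)"
  assumes "\<tau> \<in> siegel" and "dual_morphism \<tau> f g"
    and "\<And>u. f (clsB \<tau> u) = clsA \<tau> (L *v u)"
    and "\<And>n. n \<in> vecs \<int> \<Longrightarrow> L *v perB \<tau> n = perA \<tau> (map_matrix of_int F *v n)"
    and "\<And>u. g (clsB \<tau> u) = clsA \<tau> (K *v u)"
    and "\<And>n. n \<in> vecs \<int> \<Longrightarrow> K *v perB \<tau> n = perA \<tau> (map_matrix of_int H *v n)"
  shows "H = - transpose F"
proof -
  have "F $ i $ j + H $ j $ i = 0" for i j
  proof (rule real_multiples_Ints_eq_0)
    fix t :: real
    have "axis j 1 \<in> (vecs \<int> :: (real ^ ('d + 'd)) set)"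
      by (auto simp: vecs_def axis_def)
    from dual_lattice_integrality [OF assms this, of "t *\<^sub>R axis i 1"]
    show "t * of_int (F $ i $ j + H $ j $ i) \<in> \<int>"
      by (simp add: matrix_vector_mult_basis column_def inner_axis inner_axis' matrix_vector_mult_scaleR
          map_matrix_def algebra_simps)
  qed
  then have "H $ j $ i = - F $ i $ j" for i j
    by (metis add.commute eq_neg_iff_add_eq_0)
  then show ?thesis
    by (simp add: vec_eq_iff transpose_def)
qed

section \<open>The stabiliser and the fibres of the period space\<close>

text \<open>Elements of \<open>GSp\<close> move subspaces; describing the kernels of
  \<open>perA\<close> and, in the next lemma, of \<open>perB\<close> through the Hodge subspace
  makes them transportable from \<open>\<tau>\<^sub>0\<close> to \<open>\<tau>\<close>.\<close>

lemma perA_eq_0_iff: "perA \<tau> y = 0 \<longleftrightarrow> y \<in> siegel_subspace \<tau>"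
proof
  assume "perA \<tau> y = 0"
  then have "\<tau> *v lower y = upper y" by (simp add: perA_def)
  then have "y = stack (\<tau> *v lower y) (lower y)" by simp
  then show "y \<in> siegel_subspace \<tau>"
    unfolding siegel_subspace_def by (rule range_eqI)
qed (auto simp: siegel_subspace_def perA_def)

lemma perB_eq_0_iff: "perB \<tau> x = 0 \<longleftrightarrow> (\<forall>m\<in>siegel_subspace \<tau>. dotc x m = 0)"
proof -
  have "perB \<tau> x = 0 \<longleftrightarrow> upper x v* \<tau> + lower x = 0"
    unfolding perB_def vec.scale_eq_0_iff using two_pi_i_nonzero by blast
  also have "\<dots> \<longleftrightarrow> (\<forall>c. dotc (upper x v* \<tau> + lower x) c = 0)"
    using dotc_eqI [of "upper x v* \<tau> + lower x" 0] by (metis dotc_simps(9))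
  also have "\<dots> \<longleftrightarrow> (\<forall>m\<in>siegel_subspace \<tau>. dotc x m = 0)"
    by (auto simp: siegel_subspace_def dotc_split [of x] dotc_vector_matrix)
  finally show ?thesis .
qed

text \<open>
  \<open>stack 0 (u / 2\<pi>i)\<close> is a complex preimage of \<open>u\<close> under \<open>perB\<close>; the choice is immaterial when \<open>N\<close> maps
  the kernel of \<open>perB\<close> into that of \<open>perA\<close>, as it does for a morphism.
\<close>

definition tangent_map ::
  "int ^ ('d::finite + 'd) ^ ('d + 'd) \<Rightarrow> complex ^ 'd ^ 'd \<Rightarrow> complex ^ 'd \<Rightarrow> complex ^ 'd" where
  "tangent_map N \<tau> u = perA \<tau> (map_matrix of_int N *v stack 0 ((1 / two_pi_i) *s u))"

lemma tangent_map_add: "tangent_map N \<tau> (u + u') = tangent_map N \<tau> u + tangent_map N \<tau> u'"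
  and tangent_map_scale: "tangent_map N \<tau> (k *s u) = k *s tangent_map N \<tau> u"
proof -
  have "stack 0 ((1 / two_pi_i) *s (u + u')) = stack 0 ((1 / two_pi_i) *s u) + stack 0 ((1 / two_pi_i) *s u')"
    by (simp add: stack_simps vector_add_ldistrib)
  then show "tangent_map N \<tau> (u + u') = tangent_map N \<tau> u + tangent_map N \<tau> u'"
    by (simp only: tangent_map_def matrix_vector_right_distrib perA_simps)
  have "stack 0 ((1 / two_pi_i) *s (k *s u)) = k *s stack 0 ((1 / two_pi_i) *s u)"
    by (simp add: stack_simps mult.commute)
  then show "tangent_map N \<tau> (k *s u) = k *s tangent_map N \<tau> u"
    by (simp only: tangent_map_def vec_scale_matrix perA_simps)
qed

lemma G_alpha_subset: "G_alpha N \<subseteq> stab_GSp N UNIV"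
  unfolding G_alpha_def by (rule connected_component_subset)

lemma G_alpha_Rplus_subset: "G_alpha_Rplus N \<subseteq> G_alpha N \<inter> mats \<real> \<times> \<real>"
  unfolding G_alpha_Rplus_def by (rule connected_component_subset)

text \<open>At \<open>\<tau>\<^sub>0\<close> the matrix \<open>N\<close> maps the kernel of
  \<open>perB\<close> into that of \<open>perA\<close>, because it comes from the linear map
  \<open>L\<close>. An element of the stabiliser is equivariant for \<open>N\<close> and carries one
  Hodge subspace to the other, so the same inclusion holds at \<open>\<tau>\<close>, and
  \<open>N\<close> descends to the tangent spaces.\<close>

lemma tangent_map_period:
  fixes N :: "int ^ ('d::finite + 'd) ^ ('d + 'd)"
  assumes "\<And>n. n \<in> vecs \<int> \<Longrightarrow> L *v perB \<tau>\<^sub>0 n = perA \<tau>\<^sub>0 (map_matrix of_int N *v n)"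
    and "\<tau> \<in> H_alpha N \<tau>\<^sub>0"
  shows "tangent_map N \<tau> (perB \<tau> x) = perA \<tau> (map_matrix of_int N *v x)"
proof -
  let ?N = "map_matrix of_int N :: complex ^ ('d + 'd) ^ ('d + 'd)"
  obtain g \<mu> where g: "(g, \<mu>) \<in> G_alpha_Rplus N" and gF: "(\<lambda>m. g *v m) ` siegel_subspace \<tau>\<^sub>0 = siegel_subspace \<tau>"
    using assms(2) by (auto simp: H_alpha_def)
  have "(g, \<mu>) \<in> stab_GSp N UNIV"
    using g G_alpha_Rplus_subset G_alpha_subset by blast
  then have eq: "g *v (?N *v n) = ?N *v (\<mu> *s (n v* matrix_inv g))" and "det g \<noteq> 0" and "\<mu> \<noteq> 0" for n
    by (auto simp: stab_GSp_def GSp_def)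
  then have inv: "g ** matrix_inv g = mat 1"
    using someI_ex [of "\<lambda>A'. g ** A' = mat 1 \<and> A' ** g = mat 1"] invertible_det_nz [of g]
    unfolding invertible_def matrix_inv_def by blast
  have ker: "?N *v n \<in> siegel_subspace \<tau>" if n: "perB \<tau> n = 0" for n
  proof -
    have "\<forall>m\<in>siegel_subspace \<tau>\<^sub>0. dotc (n v* g) m = 0"
      using n gF by (auto simp: dotc_vector_matrix perB_eq_0_iff)
    then have "perB \<tau>\<^sub>0 (n v* g) = 0" by (simp add: perB_eq_0_iff)
    moreover have "L *v perB \<tau>\<^sub>0 (n v* g) = perA \<tau>\<^sub>0 (?N *v (n v* g))"
      by (rule lattice_map_extends) (rule assms(1))
    ultimately have "perA \<tau>\<^sub>0 (?N *v (n v* g)) = 0" by simp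
    then have "g *v (?N *v (n v* g)) \<in> siegel_subspace \<tau>"
      using gF by (auto simp: perA_eq_0_iff)
    \<comment> \<open>Equivariance is applied to \<open>n v* g\<close>, on which the inverse of
      \<open>g\<close> cancels and only the factor \<open>\<mu>\<close> remains.\<close>
    then have "\<mu> *s (?N *v n) \<in> siegel_subspace \<tau>"
      by (simp add: eq vector_matrix_mul_assoc inv vec_scale_matrix)
    then have "perA \<tau> (\<mu> *s (?N *v n)) = 0" by (simp only: perA_eq_0_iff)
    then have "perA \<tau> (?N *v n) = 0"
      using \<open>\<mu> \<noteq> 0\<close> by (simp only: perA_simps vec.scale_eq_0_iff) blast
    then show ?thesis by (simp only: perA_eq_0_iff)
  qed
  \<comment> \<open>\<open>?r\<close> is the preimage built into \<open>tangent_map\<close>; it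
    differs from \<open>x\<close> by an element of the kernel.\<close>
  let ?r = "stack 0 ((1 / two_pi_i) *s perB \<tau> x)"
  have "perB \<tau> ?r = two_pi_i *s ((1 / two_pi_i) *s perB \<tau> x)"
    by (simp only: perB_def upper_simps lower_simps vector_matrix_mult_0 add_0_left)
  also have "\<dots> = perB \<tau> x"
    using two_pi_i_nonzero by (simp only: vector_smult_assoc) simp
  finally have "perB \<tau> (x - ?r) = 0" by (simp only: perB_simps diff_self)
  then have "perA \<tau> (?N *v (x - ?r)) = 0" by (simp only: perA_eq_0_iff ker)
  then have "perA \<tau> (?N *v x) - perA \<tau> (?N *v ?r) = 0"
    by (simp only: matrix_vector_mult_diff_distrib perA_simps)
  then show ?thesis by (simp only: tangent_map_def eq_iff_diff_eq_0 [symmetric])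
qed

section \<open>Base points and the unipotent group acting on a fibre\<close>

lemma tilde_eq: "tilde \<tau> = {col 0 m t | m t. m \<in> siegel_subspace \<tau>}"
  by (auto simp: tilde_def F0_def siegel_subspace_def)

lemma act_block_tilde:
  assumes "(\<lambda>m. g *v m) ` siegel_subspace \<tau>\<^sub>0 = siegel_subspace \<tau>"
  shows "act (block \<mu> g 0 0 0) (tilde \<tau>\<^sub>0) = tilde \<tau>"
proof -
  have col: "scale0 two_pi_i (block \<mu> g 0 0 0 *v scale0 (1 / two_pi_i) (col 0 m t)) = col 0 (g *v m) t" for m t
    by (simp add: scale0_col block_mult_col)
  have "tilde \<tau>\<^sub>0 = (\<lambda>(m, t). col 0 m t) ` (siegel_subspace \<tau>\<^sub>0 \<times> UNIV)"
    unfolding tilde_eq by auto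
  then have "act (block \<mu> g 0 0 0) (tilde \<tau>\<^sub>0) = (\<lambda>(m, t). col 0 (g *v m) t) ` (siegel_subspace \<tau>\<^sub>0 \<times> UNIV)"
    by (simp add: act_def image_image case_prod_beta col)
  also have "\<dots> = {col 0 m t | m t. m \<in> (\<lambda>m. g *v m) ` siegel_subspace \<tau>\<^sub>0}"
    by auto
  finally show ?thesis by (simp only: tilde_eq assms)
qed

lemma set_mult_mat_monoid: "S <#>\<^bsub>mat_monoid UNIV\<^esub> T = {p ** q | p q. p \<in> S \<and> q \<in> T}"
  by (auto simp: set_mult_def mat_monoid_def)

lemma PuR_UC_eq: "(PuR_UC :: (complex ^ 'd::finite midx ^ 'd midx) set) = {block 1 (mat 1) x y z | x y z. x \<in> vecs \<real> \<and> y \<in> vecs \<real>}"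
proof (rule Set.set_eqI, rule iffI)
  fix p :: "complex ^ 'd midx ^ 'd midx"
  assume "p \<in> {block 1 (mat 1) x y z | x y z. x \<in> vecs \<real> \<and> y \<in> vecs \<real>}"
  then obtain x y z where p: "p = block 1 (mat 1) x y z" "x \<in> vecs \<real>" "y \<in> vecs \<real>" by blast
  have "p = block 1 (mat 1) x y 0 ** block 1 (mat 1) 0 0 z"
    by (simp add: p block_mult_block)
  moreover have "block 1 (mat 1) x y 0 \<in> Pu \<real>"
    unfolding Pu_def using p Reals_0 by blast
  moreover have "block 1 (mat 1) 0 0 z \<in> Ugrp UNIV" by (auto simp: Ugrp_def)
  ultimately show "p \<in> PuR_UC" unfolding PuR_UC_def set_mult_mat_monoid by blast
next
  fix p :: "complex ^ 'd midx ^ 'd midx"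
  assume "p \<in> PuR_UC"
  then obtain x y z z' where "x \<in> vecs \<real>" "y \<in> vecs \<real>"
    "p = block 1 (mat 1) x y z ** block 1 (mat 1) 0 0 z'"
    unfolding PuR_UC_def set_mult_mat_monoid Pu_def Ugrp_def by blast
  moreover have "block 1 (mat 1) x y z ** block 1 (mat 1) 0 0 z' = block 1 (mat 1) x y (z' + z)"
    by (simp add: block_mult_block)
  ultimately show "p \<in> {block 1 (mat 1) x y z | x y z. x \<in> vecs \<real> \<and> y \<in> vecs \<real>}"
    by blast
qed

lemma continuous_on_block:
  fixes g :: "'s::topological_space \<Rightarrow> complex ^ ('d::finite + 'd) ^ ('d + 'd)"
  assumes "continuous_on S \<mu>" "continuous_on S g" "continuous_on S x" "continuous_on S y" "continuous_on S z"
  shows "continuous_on S (\<lambda>s. block (\<mu> s) (g s) (x s) (y s) (z s))"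
  unfolding block_def
proof (intro continuous_on_vec_lambda)
  fix i j :: "'d midx"
  show "continuous_on S (\<lambda>s. case i of
      Inl _ \<Rightarrow> (case j of Inl _ \<Rightarrow> \<mu> s | Inr (Inl b) \<Rightarrow> x s $ b | Inr (Inr _) \<Rightarrow> z s)
    | Inr (Inl a) \<Rightarrow> (case j of Inl _ \<Rightarrow> 0 | Inr (Inl b) \<Rightarrow> g s $ a $ b | Inr (Inr _) \<Rightarrow> y s $ a)
    | Inr (Inr _) \<Rightarrow> (case j of Inl _ \<Rightarrow> 0 | Inr (Inl b) \<Rightarrow> 0 | Inr (Inr _) \<Rightarrow> 1))"
    by (cases i; cases "projr i"; cases j; cases "projr j"; simp add: assms continuous_on_component)
qed

text \<open>The block depends continuously on its entries, so the image of a connected product joins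
  \<open>mat 1\<close> to the given matrix inside \<open>T\<close>. It is used for the complex and
  for the real points.\<close>

lemma block_mem_connected_component:
  fixes S :: "((complex ^ ('d::finite + 'd) ^ ('d + 'd)) \<times> complex) set"
  assumes "(g, \<mu>) \<in> connected_component_set S (mat 1, 1)"
    and sub: "\<And>g m x y z. (g, m) \<in> S \<Longrightarrow> x \<in> V \<Longrightarrow> y \<in> V \<Longrightarrow> z \<in> Z \<Longrightarrow> block m g x y z \<in> T"
    and V: "connected V" "0 \<in> V" and Z: "connected Z" "0 \<in> Z"
    and xyz: "x \<in> V" "y \<in> V" "z \<in> Z"
  shows "block \<mu> g x y z \<in> connected_component_set T (mat 1)"
proof -
  obtain C where C: "connected C" "C \<subseteq> S" "(mat 1, 1) \<in> C" "(g, \<mu>) \<in> C"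
    using assms(1) by (auto simp: connected_component_def)
  let ?b = "\<lambda>((g, m), x, y, z). block m g x y z"
  have "continuous_on (C \<times> V \<times> V \<times> Z) ?b"
    unfolding case_prod_beta by (intro continuous_on_block continuous_intros)
  then have "connected (?b ` (C \<times> V \<times> V \<times> Z))"
    by (intro connected_continuous_image connected_Times C(1) V(1) Z(1))
  moreover have "?b ` (C \<times> V \<times> V \<times> Z) \<subseteq> T"
    using C(2) sub by auto
  moreover have "mat 1 \<in> ?b ` (C \<times> V \<times> V \<times> Z)"
    using C(3) V(2) Z(2) by (intro image_eqI [of _ _ "((mat 1, 1), 0, 0, 0)"]) (simp_all add: block_1)
  moreover have "block \<mu> g x y z \<in> ?b ` (C \<times> V \<times> V \<times> Z)"
    using C(4) xyz by (intro image_eqI [of _ _ "((g, \<mu>), x, y, z)"]) simp_all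
  ultimately show ?thesis unfolding connected_component_def by blast
qed

lemma convex_vecs_Reals: "convex (vecs \<real> :: (complex ^ 'n::finite) set)"
  by (auto simp: convex_def vecs_def scaleR_complex_vec intro!: Reals_add Reals_mult)

text \<open>The nested components in the definition are treated in turn: arbitrary complex
  \<open>x\<close>, \<open>y\<close>, \<open>z\<close> give membership in \<open>P_alpha\<close>,
  and then the real ones, again a connected set, stay in the component of the real points.\<close>

lemma block_mem_P_alpha_Rplus:
  assumes "(g, \<mu>) \<in> G_alpha_Rplus N" and "x \<in> vecs \<real>" "y \<in> vecs \<real>" "z \<in> \<real>"
  shows "block \<mu> g x y z \<in> P_alpha_Rplus N"
  unfolding P_alpha_Rplus_def
proof (rule block_mem_connected_component [OF assms(1) [unfolded G_alpha_Rplus_def] _ _ _ _ _ assms(2-4)])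
  fix g :: "complex ^ ('a + 'a) ^ ('a + 'a)" and \<mu> and x y :: "complex ^ ('a + 'a)" and z :: complex
  assume g: "(g, \<mu>) \<in> G_alpha N \<inter> mats \<real> \<times> \<real>" and r: "x \<in> vecs \<real>" "y \<in> vecs \<real>" "z \<in> \<real>"
  have "block \<mu> g x y z \<in> P_alpha N"
    unfolding P_alpha_def
  proof (rule block_mem_connected_component [where V = UNIV and Z = UNIV])
    show "(g, \<mu>) \<in> connected_component_set (stab_GSp N UNIV) (mat 1, 1)"
      using g by (simp add: G_alpha_def)
    show "block m g x y z \<in> stab_P N UNIV" if "(g, m) \<in> stab_GSp N UNIV" for g m x y z
      unfolding stab_P_def vecs_UNIV using that by blast
  qed auto
  moreover have "block \<mu> g x y z \<in> mats \<real>"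
    using g r by (auto simp: mats_def vecs_def block_def split: sum.split)
  ultimately show "block \<mu> g x y z \<in> P_alpha N \<inter> mats \<real>" by simp
next
  have "convex (\<real> :: complex set)"
    by (auto simp: convex_def scaleR_conv_of_real intro!: Reals_add Reals_mult)
  then show "connected (\<real> :: complex set)" by (rule convex_connected)
qed (simp_all add: convex_connected convex_vecs_Reals, simp_all add: vecs_def)

lemma vecs_Reals_matrix:
  assumes "x \<in> vecs \<real>" "g \<in> mats \<real>"
  shows "x v* g \<in> vecs \<real>"
  using assms by (auto simp: vecs_def mats_def vector_matrix_mult_def intro!: sum_in_Reals Reals_mult)

text \<open>Real coordinates of \<open>u\<close> and \<open>v\<close> exist and are unique; once
  \<open>x\<close> and \<open>y\<close> are fixed, the last coordinate is an affine function of the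
  complex corner entry \<open>z\<close> with slope \<open>two_pi_i\<close>.\<close>

lemma bij_PuR_UC_D_fibre:
  assumes "\<tau> \<in> siegel"
  shows "bij_betw (\<lambda>p. act p (tilde \<tau>)) PuR_UC (D_fibre \<tau>)"
proof (rule bij_betw_imageI)
  have act: "act (block 1 (mat 1) x y z) (tilde \<tau>) =
      F0 \<tau> (perB \<tau> x) (perA \<tau> y) (two_pi_i * z - dotc (perB \<tau> x) (lower y))" for x y z
    by (simp add: tilde_def act_F0)
  show "inj_on (\<lambda>p. act p (tilde \<tau>)) PuR_UC"
    unfolding PuR_UC_eq inj_on_def
    by (auto simp: act vecs_Reals perA_real_inj [OF assms] perB_real_inj [OF assms])
  show "(\<lambda>p. act p (tilde \<tau>)) ` PuR_UC = D_fibre \<tau>"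
  proof (intro subset_antisym subsetI)
    fix F assume "F \<in> D_fibre \<tau>"
    then obtain u v w where F: "F = F0 \<tau> u v w" by (auto simp: D_fibre_def)
    obtain x y where "u = perB \<tau> (cvec x)" "v = perA \<tau> (cvec y)"
      using perA_real_ex [OF assms] perB_real_ex [OF assms] by metis
    moreover define z where "z = (w + dotc u (lower (cvec y))) / two_pi_i"
    moreover have "two_pi_i * z = w + dotc u (lower (cvec y))"
      by (simp add: z_def)
    ultimately have "F = act (block 1 (mat 1) (cvec x) (cvec y) z) (tilde \<tau>)"
      unfolding act F by simp
    then show "F \<in> (\<lambda>p. act p (tilde \<tau>)) ` PuR_UC"
      unfolding PuR_UC_eq vecs_Reals by blast
  qed (auto simp: PuR_UC_eq act D_fibre_def)
qed

text \<open>One inclusion is part of the definition. For the other, the unipotent group moves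
  \<open>tilde \<tau>\<close> to every point of the fibre, and the block of \<open>g\<close> moves
  \<open>tilde \<tau>\<^sub>0\<close> to \<open>tilde \<tau>\<close>.\<close>

lemma D_alpha_fibre_eq:
  fixes \<tau> :: "complex ^ 'd::finite ^ 'd"
  assumes "\<tau> \<in> H_alpha N \<tau>\<^sub>0"
  shows "D_alpha_fibre N \<tau>\<^sub>0 \<tau> = D_fibre \<tau>"
proof (intro subset_antisym subsetI)
  fix F assume F: "F \<in> D_fibre \<tau>"
  have \<tau>: "\<tau> \<in> siegel" using assms by (simp add: H_alpha_def)
  obtain g \<mu> where g: "(g, \<mu>) \<in> G_alpha_Rplus N" and gF: "(\<lambda>m. g *v m) ` siegel_subspace \<tau>\<^sub>0 = siegel_subspace \<tau>"
    using assms by (auto simp: H_alpha_def)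
  have stab: "(g, \<mu>) \<in> stab_GSp N UNIV" and real: "g \<in> mats \<real>"
    using g G_alpha_Rplus_subset [of N] G_alpha_subset [of N] by blast+
  then have "\<mu> \<noteq> 0" by (simp add: stab_GSp_def GSp_def)
  obtain x y z where xy: "x \<in> vecs \<real>" "y \<in> vecs \<real>" and "F = act (block 1 (mat 1) x y z) (tilde \<tau>)"
    using F bij_betw_imp_surj_on [OF bij_PuR_UC_D_fibre [OF \<tau>]] unfolding PuR_UC_eq by blast
  then have "F = act (block 1 (mat 1) x y z ** block \<mu> g 0 0 0) (tilde \<tau>\<^sub>0)"
    by (simp add: act_block_tilde [OF gF] flip: act_act)
  \<comment> \<open>The complex corner entry must stand on the right, in \<open>Ugrp\<close>;
    passing it across the block of \<open>g\<close> divides it by \<open>\<mu>\<close>.\<close>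
  also have "block 1 (mat 1) x y z ** block \<mu> g 0 0 0 = block \<mu> g (x v* g) y 0 ** block 1 (mat 1) 0 0 (z / \<mu>)"
    using \<open>\<mu> \<noteq> 0\<close> by (simp add: block_mult_block)
  finally have F: "F = act (block \<mu> g (x v* g) y 0 ** block 1 (mat 1) 0 0 (z / \<mu>)) (tilde \<tau>\<^sub>0)" .
  have "block \<mu> g (x v* g) y 0 \<in> P_alpha_Rplus N"
    by (intro block_mem_P_alpha_Rplus g xy vecs_Reals_matrix real) auto
  moreover have "block 1 (mat 1) 0 0 (z / \<mu>) \<in> Ugrp UNIV"
    by (auto simp: Ugrp_def)
  ultimately have "F \<in> D_alpha N \<tau>\<^sub>0"
    unfolding F D_alpha_def set_mult_mat_monoid by blast
  with \<open>F \<in> D_fibre \<tau>\<close> show "F \<in> D_alpha_fibre N \<tau>\<^sub>0 \<tau>"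
    by (auto simp: D_alpha_fibre_def D_fibre_def)
qed (auto simp: D_alpha_fibre_def D_fibre_def)

section \<open>The Ribet section\<close>

text \<open>The second part supplies the factor 2 that compensates the halving in
  \<open>half_pairing\<close> and leaves the integral matrix \<open>M\<close>.\<close>

lemma of_int_matrix_dotc_symmetric:
  assumes "N = M + transpose (M :: int ^ 'n::finite ^ 'n)"
  shows "dotc x (map_matrix of_int N *v y) = dotc y (map_matrix of_int N *v x)"
    and "dotc x (map_matrix of_int N *v x) = 2 * dotc x (map_matrix of_int M *v x)"
proof -
  let ?M = "map_matrix of_int M :: complex ^ 'n ^ 'n"
  have "map_matrix of_int N = ?M + transpose ?M"
    by (simp add: assms map_matrix_def transpose_def vec_eq_iff)
  then have "dotc x (map_matrix of_int N *v y) = dotc x (?M *v y) + dotc y (?M *v x)" for x y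
    by (simp add: matrix_vector_mult_add_rdistrib) (metis dotc_commute dotc_vector_matrix)
  then show "dotc x (map_matrix of_int N *v y) = dotc y (map_matrix of_int N *v x)"
    "dotc x (map_matrix of_int N *v x) = 2 * dotc x (?M *v x)" by simp_all
qed

text \<open>In the application \<open>N\<close> is \<open>\<alpha>\<^sub>Z\<close> and
  \<open>M\<close> is \<open>f\<^sub>Z\<close>; \<open>period\<close> expresses that
  \<open>N\<close> induces a morphism at \<open>\<tau>\<close>.\<close>

locale symmetric_lattice_map =
  fixes \<tau> :: "complex ^ 'd::finite ^ 'd" and N M :: "int ^ ('d + 'd) ^ ('d + 'd)"
  assumes siegel: "\<tau> \<in> siegel"
    and period: "\<And>x. tangent_map N \<tau> (perB \<tau> x) = perA \<tau> (map_matrix of_int N *v x)"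
    and symmetric: "N = M + transpose M"
begin

definition coords :: "complex ^ 'd \<Rightarrow> real ^ ('d + 'd)" where
  "coords = inv_into UNIV (\<lambda>x. perB \<tau> (cvec x))"

lemma perB_coords [simp]: "perB \<tau> (cvec (coords u)) = u"
  unfolding coords_def using surj_f_inv_f [OF bij_is_surj [OF perB_cvec_iso(1) [OF siegel]]] .

lemma coords_perB [simp]: "coords (perB \<tau> (cvec x)) = x"
  using perB_real_inj [OF siegel, of "coords (perB \<tau> (cvec x))" x] by simp

text \<open>The form \<open>R\<close> of the introduction, in the shape that is visibly complex
  linear in \<open>u'\<close>.\<close>

definition pairing :: "complex ^ 'd \<Rightarrow> complex ^ 'd \<Rightarrow> complex" where
  "pairing u u' = two_pi_i * dotc (upper (cvec (coords u))) (tangent_map N \<tau> u') -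
     dotc u' (lower (map_matrix of_int N *v cvec (coords u)))"

text \<open>\<open>dotc_period\<close> leads to a shape in which exchanging the arguments swaps the
  last two terms and fixes the first by the symmetry of \<open>N\<close>.\<close>

lemma pairing_eq:
  "pairing u u' = two_pi_i * dotc (cvec (coords u)) (map_matrix of_int N *v cvec (coords u')) -
     dotc u (lower (map_matrix of_int N *v cvec (coords u'))) -
     dotc u' (lower (map_matrix of_int N *v cvec (coords u)))"
proof -
  have "tangent_map N \<tau> u' = perA \<tau> (map_matrix of_int N *v cvec (coords u'))"
    by (metis perB_coords period)
  then show ?thesis
    unfolding pairing_def by (simp add: dotc_period [of "cvec (coords u)" _ \<tau>] del: mult_eq_0_iff)
qed

lemma pairing_commute: "pairing u u' = pairing u' u"
  unfolding pairing_eq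
  using of_int_matrix_dotc_symmetric(1) [OF symmetric, of "cvec (coords u)" "cvec (coords u')"]
  by simp

lemma pairing_add_right: "pairing u (a + b) = pairing u a + pairing u b"
  and pairing_scale_right: "pairing u (k *s a) = k * pairing u a"
  by (simp_all add: pairing_def tangent_map_add tangent_map_scale algebra_simps)

text \<open>The symmetry upgrades real linearity in the first argument to complex linearity.\<close>

lemma pairing_add_left: "pairing (a + b) u = pairing a u + pairing b u"
  and pairing_scale_left: "pairing (k *s a) u = k * pairing a u"
  by (metis pairing_commute pairing_add_right, metis pairing_commute pairing_scale_right)

lemma bounded_bilinear_pairing: "bounded_bilinear pairing"
  unfolding bilinear_conv_bounded_bilinear [symmetric] bilinear_def
  by (intro conjI allI linearI)
    (simp_all add: pairing_add_left pairing_add_right pairing_scale_left pairing_scale_right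
      scaleR_complex_vec scaleR_conv_of_real)

definition half_pairing :: "complex ^ 'd \<Rightarrow> complex" where
  "half_pairing u = 1 / 2 * pairing u u"

lemma holo_fun_half_pairing: "holo_fun S half_pairing"
proof -
  have "((\<lambda>u. pairing u u) has_derivative (\<lambda>h. pairing u h + pairing h u)) (at u)" for u
    by (rule bounded_bilinear.FDERIV [OF bounded_bilinear_pairing]) (rule has_derivative_ident)+
  then have "holo_fun S (\<lambda>u. pairing u u)"
    unfolding holo_fun_def
    by (intro ballI exI conjI) (auto simp: pairing_scale_left pairing_scale_right distrib_left)
  then have "holo_fun S (\<lambda>u. 1 / 2 * pairing u u)" by (rule holo_fun_cmult)
  then show ?thesis by (simp add: half_pairing_def [abs_def])
qed

text \<open>On the diagonal the first term of \<open>pairing_eq\<close> is twice the term with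
  \<open>M\<close> and the last two agree, so the factor one half leaves no denominator.\<close>

lemma half_pairing_perB:
  "half_pairing (perB \<tau> (cvec x)) = two_pi_i * dotc (cvec x) (map_matrix of_int M *v cvec x) -
     dotc (perB \<tau> (cvec x)) (lower (map_matrix of_int N *v cvec x))"
  unfolding half_pairing_def pairing_eq coords_perB of_int_matrix_dotc_symmetric(2) [OF symmetric]
  by (simp add: algebra_simps)

lemma half_pairing_add: "half_pairing (u + p) = half_pairing u + pairing p u + half_pairing p"
  by (simp add: half_pairing_def pairing_add_left pairing_add_right pairing_commute [of u p] algebra_simps)

definition lifted_section :: "complex ^ 'd \<Rightarrow> (complex ^ 'd midx) set set" where
  "lifted_section u = pt \<tau> u (tangent_map N \<tau> u) (half_pairing u)"

text \<open>A period moves the three coordinates exactly as the translation with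
  \<open>x = n\<close>, \<open>y = map_matrix of_int N *v n\<close> and
  \<open>z = dotc n (map_matrix of_int M *v n)\<close> does. This \<open>z\<close> is an integer
  because \<open>M\<close> is integral, which is where the decomposition of \<open>N\<close>
  enters.\<close>

lemma lifted_section_periodic:
  assumes "n \<in> vecs \<int>"
  shows "lifted_section (u + perB \<tau> n) = lifted_section u"
proof -
  obtain m where m: "m \<in> vecs \<int>" "n = cvec m" using assms by (auto simp: vecs_Ints_complex)
  have "half_pairing (u + perB \<tau> n) = half_pairing u +
      two_pi_i * (dotc n (map_matrix of_int M *v n) + dotc (upper n) (tangent_map N \<tau> u)) -
      dotc (u + perB \<tau> n) (lower (map_matrix of_int N *v n))"
    unfolding half_pairing_add m(2) half_pairing_perB pairing_def coords_perB distrib_left dotc_simps by (simp only: algebra_simps)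
  then have "lifted_section (u + perB \<tau> n) = pt \<tau> (u + perB \<tau> n)
      (tangent_map N \<tau> u + perA \<tau> (map_matrix of_int N *v n)) (half_pairing u +
      two_pi_i * (dotc n (map_matrix of_int M *v n) + dotc (upper n) (tangent_map N \<tau> u)) -
      dotc (u + perB \<tau> n) (lower (map_matrix of_int N *v n)))"
    by (simp only: lifted_section_def tangent_map_add period)
  also have "\<dots> = lifted_section u"
    unfolding lifted_section_def
    by (rule pt_shift [OF assms of_int_matrix_Ints [OF assms] dotc_Ints [OF assms of_int_matrix_Ints [OF assms]]])
  finally show ?thesis .
qed

lemma lifted_section_cong: "clsB \<tau> u = clsB \<tau> u' \<Longrightarrow> lifted_section u = lifted_section u'"
  unfolding clsB_eq_iff using lifted_section_periodic [of _ u'] by (metis add.commute diff_add_cancel imageE)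

text \<open>The representative chosen by \<open>SOME\<close> is immaterial by
  \<open>lifted_section_cong\<close>; \<open>restrict\<close> selects the extensional function that
  \<open>ribet_section\<close> asks for.\<close>

definition global_section :: "(complex ^ 'd) set \<Rightarrow> (complex ^ 'd midx) set set" where
  "global_section = restrict (\<lambda>b. lifted_section (SOME u. clsB \<tau> u = b)) (carrier (avB \<tau>))"

lemma global_section_clsB: "global_section (clsB \<tau> u) = lifted_section u"
proof -
  have "clsB \<tau> (SOME u'. clsB \<tau> u' = clsB \<tau> u) = clsB \<tau> u" by (rule someI) (rule refl)
  from lifted_section_cong [OF this] show ?thesis by (simp add: global_section_def carrier_avB)
qed

lemma tangent_map_0: "tangent_map N \<tau> 0 = 0"
  using period [of 0] by simp

lemma is_ribet_section_global_section: "is_ribet_section \<tau> N global_section"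
  unfolding is_ribet_section_def
proof (intro conjI allI)
  show "global_section (ptB \<tau> x) \<in> poincare_fibre \<tau> (clsA \<tau> (perA \<tau> (map_matrix of_int N *v cvec x))) (ptB \<tau> x)" for x
    by (simp add: ptB_def global_section_clsB poincare_fibre_eq lifted_section_def period)
  show "\<exists>O' v w. open O' \<and> p \<in> O' \<and> holo_map O' v \<and> holo_fun O' w \<and>
        (\<forall>q\<in>O'. global_section (clsB \<tau> q) = pt \<tau> q (v q) (w q))" for p
  proof (intro exI conjI)
    show "holo_map UNIV (tangent_map N \<tau>)"
      unfolding holo_map_def by (intro allI holo_funI_linear) (simp_all add: tangent_map_add tangent_map_scale)
    show "holo_fun UNIV half_pairing" by (rule holo_fun_half_pairing)
  qed (auto simp: global_section_clsB lifted_section_def)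
  show "global_section \<one>\<^bsub>avB \<tau>\<^esub> = unit_section \<tau> \<one>\<^bsub>avB \<tau>\<^esub>"
    using half_pairing_perB [of 0]
    by (simp add: one_avB global_section_clsB unit_section_def one_ext_group [OF siegel] lifted_section_def tangent_map_0)
qed

lemma ribet_section_unique:
  assumes s: "is_ribet_section \<tau> N s"
  shows "s (clsB \<tau> u) = lifted_section u"
proof -
  have "\<exists>c. s (clsB \<tau> q) = pt \<tau> q (tangent_map N \<tau> q) c" for q
  proof -
    have "s (ptB \<tau> (coords q)) \<in>
        poincare_fibre \<tau> (clsA \<tau> (perA \<tau> (map_matrix of_int N *v cvec (coords q)))) (ptB \<tau> (coords q))"
      using s unfolding is_ribet_section_def by blast
    then show ?thesis
      by (auto simp: ptB_def poincare_fibre_eq simp flip: period)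
  qed
  then obtain c where c: "\<And>q. s (clsB \<tau> q) = pt \<tau> q (tangent_map N \<tau> q) (c q)" by metis
  \<comment> \<open>The quotient of the two sections; unlike \<open>c\<close> it does not depend on
    choices, and it is invariant under periods.\<close>
  define \<delta> where "\<delta> q = exp (c q - half_pairing q)" for q
  have twist: "s (clsB \<tau> q) = torsor_act \<tau> (\<delta> q) (lifted_section q)" for q
    using torsor_act_pt [of "c q - half_pairing q" "\<delta> q" \<tau> q "tangent_map N \<tau> q" "half_pairing q"]
    by (simp add: c lifted_section_def \<delta>_def)
  have "\<delta> (q + perB \<tau> n) = \<delta> q" if n: "n \<in> vecs \<int>" for q n
  proof -
    have "clsB \<tau> (q + perB \<tau> n) = clsB \<tau> q"
      by (simp add: clsB_eq_iff n)
    then have "torsor_act \<tau> (\<delta> (q + perB \<tau> n)) (lifted_section q) = torsor_act \<tau> (\<delta> q) (lifted_section q)"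
      using twist [of "q + perB \<tau> n"] twist [of q] by (simp add: lifted_section_periodic [OF n])
    then have "exp (half_pairing q + (c (q + perB \<tau> n) - half_pairing (q + perB \<tau> n))) = exp (half_pairing q + (c q - half_pairing q))"
      by (simp only: lifted_section_def \<delta>_def torsor_act_pt [OF refl] pt_eq_exp_iff [OF siegel])
    then have "exp (half_pairing q) * \<delta> (q + perB \<tau> n) = exp (half_pairing q) * \<delta> q"
      by (simp only: \<delta>_def exp_add)
    then show ?thesis by (simp only: mult_left_cancel [OF exp_not_eq_zero])
  qed
  moreover have "holo_fun UNIV \<delta>"
  proof (rule holo_fun_local)
    fix p
    obtain U v w where U: "open U" "p \<in> U" and hol: "holo_map U v" "holo_fun U w"
      and sv: "\<forall>q\<in>U. s (clsB \<tau> q) = pt \<tau> q (v q) (w q)"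
      using s unfolding is_ribet_section_def by metis
    have lin: "continuous_on U (tangent_map N \<tau>)"
      by (rule holo_map_continuous_on)
        (simp add: holo_map_def holo_funI_linear tangent_map_add tangent_map_scale)
    \<comment> \<open>Both terms lift the same map into \<open>A\<close>, so they differ by a
      locally constant period, which \<open>pt_shift_v\<close> moves into \<open>w\<close>.\<close>
    have "v q - tangent_map N \<tau> q \<in> perA \<tau> ` vecs \<int>" if "q \<in> U" for q
    proof -
      have "clsA \<tau> (v q) = clsA \<tau> (tangent_map N \<tau> q)"
        using sv that c [of q] by (metis projA_pt)
      then show ?thesis by (simp add: clsA_eq_iff)
    qed
    then obtain U' y where U': "open U'" "p \<in> U'" "U' \<subseteq> U" and y: "y \<in> vecs \<int>"
      "\<forall>q\<in>U'. v q - tangent_map N \<tau> q = perA \<tau> y"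
      using perA_Ints_locally_const [OF siegel U, of "\<lambda>q. v q - tangent_map N \<tau> q"]
        continuous_on_diff [OF holo_map_continuous_on [OF hol(1)] lin] by blast
    have "\<delta> q = exp (w q + dotc q (lower y) - half_pairing q)" if q: "q \<in> U'" for q
    proof -
      have "v q = tangent_map N \<tau> q + perA \<tau> y" using y(2) q by (metis add.commute diff_add_cancel)
      then have "pt \<tau> q (tangent_map N \<tau> q) (c q) = pt \<tau> q (tangent_map N \<tau> q) (w q + dotc q (lower y))"
        using sv U'(3) q c [of q] pt_shift_v [OF y(1), of \<tau> q] by (metis subsetD)
      then show ?thesis
        by (simp add: pt_eq_exp_iff [OF siegel] \<delta>_def exp_diff)
    qed
    moreover have "holo_fun U' (\<lambda>q. exp (w q + dotc q (lower y) - half_pairing q))"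
      by (intro holo_fun_exp holo_fun_diff holo_fun_add holo_fun_dotc holo_fun_half_pairing holo_fun_subset [OF hol(2) U'(3)])
    ultimately show "\<exists>N h. open N \<and> p \<in> N \<and> holo_fun N h \<and> (\<forall>q\<in>N. \<delta> q = h q)"
      using U' by blast
  qed
  ultimately have "\<delta> u = \<delta> 0"
    by (intro entire_norm_periodic_const [OF siegel]) simp_all
  moreover have "\<delta> 0 = 1"
  proof -
    have "s (clsB \<tau> 0) = global_section (clsB \<tau> 0)"
      using s is_ribet_section_global_section by (simp add: is_ribet_section_def flip: one_avB)
    then have "exp (c 0) = exp (half_pairing 0)"
      by (simp only: c global_section_clsB lifted_section_def pt_eq_exp_iff [OF siegel])
    then show ?thesis by (simp add: \<delta>_def exp_diff)
  qed
  ultimately have "exp (c u) = exp (half_pairing u)" by (simp add: \<delta>_def exp_diff)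
  then show ?thesis by (simp only: c lifted_section_def pt_eq_exp_iff [OF siegel])
qed

lemma ribet_section_clsB: "ribet_section \<tau> N (clsB \<tau> u) = lifted_section u"
proof -
  have "ribet_section \<tau> N = global_section"
    unfolding ribet_section_def
  proof (rule the_equality)
    show "global_section \<in> extensional (carrier (avB \<tau>)) \<and> is_ribet_section \<tau> N global_section"
      using is_ribet_section_global_section by (simp add: global_section_def)
    fix s assume s: "s \<in> extensional (carrier (avB \<tau>)) \<and> is_ribet_section \<tau> N s"
    show "s = global_section"
    proof (rule extensionalityI)
      show "s \<in> extensional (carrier (avB \<tau>))" "global_section \<in> extensional (carrier (avB \<tau>))"
        using s by (simp_all add: global_section_def)
      show "s b = global_section b" if "b \<in> carrier (avB \<tau>)" for b
        using that s ribet_section_unique global_section_clsB by (auto simp: carrier_avB)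
    qed
  qed
  then show ?thesis by (simp add: global_section_clsB)
qed

lemma ribet_section_ptB:
  "ribet_section \<tau> N (ptB \<tau> x) = pt \<tau> (perB \<tau> (cvec x)) (perA \<tau> (cvec (map_matrix of_int N *v x)))
     (two_pi_i * of_real (x \<bullet> (map_matrix of_int M *v x)) -
      dotc (perB \<tau> (cvec x)) (lower (cvec (map_matrix of_int N *v x))))"
  unfolding ptB_def ribet_section_clsB lifted_section_def period half_pairing_perB of_int_matrix_cvec dotc_cvec ..

end

section \<open>The real Lie group structure\<close>

lemma Ck_const: "Ck k S (\<lambda>x. c)"
  by (induction k arbitrary: c) (auto intro!: exI [of _ "\<lambda>x h. 0"])

text \<open>The derivative of \<open>h\<close> at every point is \<open>h\<close> itself, so the
  higher orders reduce to \<open>Ck_const\<close>.\<close>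

lemma smooth_bounded_linear:
  assumes "bounded_linear h" shows "smooth S h"
  unfolding smooth_def
proof
  show "Ck k S h" for k
    by (cases k)
      (auto intro!: exI [of _ "\<lambda>x. h"] Ck_const bounded_linear_imp_has_derivative assms linear_continuous_on)
qed

lemma locally_lifts_smooth_linear:
  assumes "bounded_linear h" and "\<And>r. \<phi> (q1 r) = q2 (h r)"
  shows "locally_lifts smooth q1 q2 \<phi>"
  unfolding locally_lifts_def
  using smooth_bounded_linear [OF assms(1), of UNIV] assms(2) by (metis UNIV_I open_UNIV)

section \<open>The product of the complex cylinder and the real torus\<close>

lemma exp_eq_iff_two_pi_i_Ints: "exp s = exp s' \<longleftrightarrow> s - s' \<in> range (\<lambda>k::int. two_pi_i * of_int k)"
proof -
  have "exp s = exp s' \<longleftrightarrow> (\<exists>z\<in>\<int>. s = s' + two_pi_i * z)"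
    unfolding exp_eq_iff_period [symmetric] by metis
  also have "\<dots> \<longleftrightarrow> (\<exists>k::int. s - s' = two_pi_i * of_int k)"
    unfolding Ints_def by (auto simp: algebra_simps)
  finally show ?thesis by (simp only: image_iff) simp
qed

lemma std_cls_eq_iff: "std_cls (s, y) = std_cls (s', y') \<longleftrightarrow> exp s = exp s' \<and> y - y' \<in> vecs \<int>"
  unfolding std_cls_def prod.case prod.inject exp_eq_iff_two_pi_i_Ints
    additive_subgroup_of_vectors.coset_eq_iff [OF additive_subgroup_two_pi_i]
    additive_subgroup_of_vectors.coset_eq_iff [OF additive_subgroup_Ints] ..

lemma carrier_std_group: "carrier std_group = range std_cls"
  unfolding std_group_def std_cls_def carrier_DirProd
    additive_subgroup_of_vectors.carrier_Mod [OF additive_subgroup_two_pi_i]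
    additive_subgroup_of_vectors.carrier_Mod [OF additive_subgroup_Ints]
  by (auto simp: image_iff)

lemma mult_std_group: "std_cls a \<otimes>\<^bsub>std_group\<^esub> std_cls b = std_cls (a + b)"
  by (cases a; cases b) (simp add: std_group_def std_cls_def
    additive_subgroup_of_vectors.mult_Mod [OF additive_subgroup_two_pi_i]
    additive_subgroup_of_vectors.mult_Mod [OF additive_subgroup_Ints] del: mult_FactGroup)

text \<open>For \<open>u = perB \<tau> (cvec x)\<close> and \<open>s = two_pi_i * z\<close> these
  are the coordinates \<open>(v, w)\<close> found in \<open>act_p_zy_p_x\<close>. The correction by
  \<open>u\<close> lets an integral change of \<open>y\<close> leave \<open>s\<close>
  unaltered.\<close>

definition ext_param :: "complex ^ 'd::finite ^ 'd \<Rightarrow> complex ^ 'd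
    \<Rightarrow> complex \<times> (real ^ ('d + 'd)) \<Rightarrow> (complex ^ 'd) \<times> complex" where
  "ext_param \<tau> u = (\<lambda>(s, y). (perA \<tau> (cvec y), s - dotc u (lower (cvec y))))"

lemma bounded_linear_ext_param: "bounded_linear (ext_param \<tau> u)"
  unfolding linear_conv_bounded_linear [symmetric]
  by (rule linearI) (auto simp: ext_param_def scaleR_complex_vec scaleR_conv_of_real [where 'a = complex] algebra_simps)

lemma bounded_linear_ext_param_inverse:
  assumes "\<tau> \<in> siegel"
  shows "\<exists>h. bounded_linear h \<and> (\<forall>r. ext_param \<tau> u (h r) = r)"
proof -
  define k where "k = inv_into UNIV (\<lambda>y. perA \<tau> (cvec y))"
  have k: "perA \<tau> (cvec (k v)) = v" for v
    unfolding k_def using surj_f_inv_f [OF bij_is_surj [OF perA_cvec_iso(1) [OF assms]]] .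
  have lin: "linear k"
    unfolding k_def linear_conv_bounded_linear by (rule perA_cvec_iso(2) [OF assms])
  have "linear (\<lambda>(v, w). (w + dotc u (lower (cvec (k v))), k v))"
    by (rule linearI) (auto simp: linear_add [OF lin] linear_scale [OF lin] scaleR_conv_of_real [where 'a = complex] algebra_simps)
  then show ?thesis
    unfolding linear_conv_bounded_linear by (intro exI conjI) (auto simp: ext_param_def k)
qed

text \<open>An integral change of \<open>y\<close> is a translation in \<open>v\<close>, whose
  effect on the last coordinate is exactly the correction in \<open>ext_param\<close>. Conversely
  \<open>projA\<close> recovers \<open>y\<close> modulo integral vectors, and
  \<open>pt_eq_exp_iff\<close> recovers \<open>exp s\<close>.\<close>

lemma pt_ext_param_eq_iff:
  fixes y y' :: "real ^ ('d::finite + 'd)"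
  assumes "\<tau> \<in> siegel"
  shows "case_prod (pt \<tau> u) (ext_param \<tau> u (s, y)) = case_prod (pt \<tau> u) (ext_param \<tau> u (s', y')) \<longleftrightarrow>
    std_cls (s, y) = std_cls (s', y')"
proof -
  have 1: "case_prod (pt \<tau> u) (ext_param \<tau> u (s, y)) = case_prod (pt \<tau> u) (ext_param \<tau> u (s', y')) \<longleftrightarrow> exp s = exp s'"
    if n: "y - y' \<in> vecs \<int>"
  proof -
    have "cvec (y - y') \<in> vecs \<int>" using n by (simp only: cvec_Ints_iff)
    from pt_shift_v [OF this, of \<tau> u "perA \<tau> (cvec y')" "s - dotc u (lower (cvec y))"]
    have "pt \<tau> u (perA \<tau> (cvec y)) (s - dotc u (lower (cvec y))) =
        pt \<tau> u (perA \<tau> (cvec y')) (s - dotc u (lower (cvec y')))" by simp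
    then show ?thesis
      by (simp add: ext_param_def pt_eq_exp_iff [OF assms] exp_diff)
  qed
  have 2: "y - y' \<in> vecs \<int>"
    if "case_prod (pt \<tau> u) (ext_param \<tau> u (s, y)) = case_prod (pt \<tau> u) (ext_param \<tau> u (s', y'))"
  proof -
    have "clsA \<tau> (perA \<tau> (cvec y)) = clsA \<tau> (perA \<tau> (cvec y'))"
      using arg_cong [OF that, of "projA \<tau>"] by (simp add: ext_param_def projA_pt)
    then obtain n where "n \<in> vecs \<int>" "perA \<tau> (cvec (y - y')) = perA \<tau> (cvec n)"
      by (auto simp: clsA_eq_iff vecs_Ints_complex)
    then show ?thesis by (simp only: perA_real_inj [OF assms])
  qed
  show ?thesis unfolding std_cls_eq_iff using 1 2 by metis
qed

text \<open>\<open>\<Phi>\<close> is induced by the linear map \<open>ext_param\<close> on the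
  covering vector spaces, which has a linear right inverse \<open>h\<close>; so
  \<open>\<Phi>\<close> and its inverse have bounded linear lifts.\<close>

lemma ext_group_lie_iso:
  fixes u :: "complex ^ 'd::finite"
  assumes "\<tau> \<in> siegel"
  shows "\<exists>\<Phi>. lie_iso std_cls std_group (\<lambda>(v, w). pt \<tau> u v w) (ext_group \<tau> (clsB \<tau> u)) \<Phi> \<and>
    (\<forall>s y. \<Phi> (std_cls (s, y)) = pt \<tau> u (perA \<tau> (cvec y)) (s - dotc u (lower (cvec y))))"
proof -
  define \<psi> where "\<psi> a = case_prod (pt \<tau> u) (ext_param \<tau> u a)" for a
  define \<Phi> where "\<Phi> c = \<psi> (SOME a. std_cls a = c)" for c
  have \<psi>_eq: "\<psi> a = \<psi> b \<longleftrightarrow> std_cls a = std_cls b" for a b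
    unfolding \<psi>_def by (cases a; cases b) (simp only: pt_ext_param_eq_iff [OF assms])
  have \<Phi>: "\<Phi> (std_cls a) = \<psi> a" for a
    unfolding \<Phi>_def \<psi>_eq by (rule someI) (rule refl)
  obtain h where h: "bounded_linear h" "\<And>r. ext_param \<tau> u (h r) = r"
    using bounded_linear_ext_param_inverse [OF assms] by metis
  have \<psi>h: "\<psi> (h r) = case_prod (pt \<tau> u) r" for r
    by (simp add: \<psi>_def h(2))
  have inj: "inj_on \<Phi> (carrier std_group)"
    by (auto simp: inj_on_def carrier_std_group \<Phi> \<psi>_eq)
  have carr: "carrier (ext_group \<tau> (clsB \<tau> u)) = range (case_prod (pt \<tau> u))"
    by (auto simp: carrier_ext_group)
  have "range \<psi> = range (case_prod (pt \<tau> u))"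
    using \<psi>h by (auto simp: \<psi>_def) (metis rangeI)+
  then have "\<Phi> ` carrier std_group = carrier (ext_group \<tau> (clsB \<tau> u))"
    by (simp add: carrier_std_group carr image_image \<Phi>)
  moreover have "\<psi> (a + b) = \<psi> a \<otimes>\<^bsub>ext_group \<tau> (clsB \<tau> u)\<^esub> \<psi> b" for a b
    by (cases a; cases b) (simp add: \<psi>_def ext_param_def mult_ext_group [OF assms] algebra_simps)
  ultimately have "\<Phi> \<in> iso std_group (ext_group \<tau> (clsB \<tau> u))"
    using inj by (auto simp: iso_def hom_def bij_betw_def carrier_std_group \<Phi> mult_std_group)
  moreover have "locally_lifts smooth std_cls (\<lambda>(v, w). pt \<tau> u v w) \<Phi>"
    by (rule locally_lifts_smooth_linear [OF bounded_linear_ext_param]) (simp add: \<Phi> \<psi>_def)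
  moreover have "locally_lifts smooth (\<lambda>(v, w). pt \<tau> u v w) std_cls (inv_into (carrier std_group) \<Phi>)"
  proof (rule locally_lifts_smooth_linear [OF h(1)])
    show "inv_into (carrier std_group) \<Phi> ((\<lambda>(v, w). pt \<tau> u v w) r) = std_cls (h r)" for r
      by (rule inv_into_f_eq [OF inj]) (simp_all add: carrier_std_group \<Phi> \<psi>h)
  qed
  ultimately have "lie_iso std_cls std_group (\<lambda>(v, w). pt \<tau> u v w) (ext_group \<tau> (clsB \<tau> u)) \<Phi>"
    by (simp add: lie_iso_def)
  moreover have "\<Phi> (std_cls (s, y)) = pt \<tau> u (perA \<tau> (cvec y)) (s - dotc u (lower (cvec y)))" for s y
    by (simp add: \<Phi> \<psi>_def ext_param_def)
  ultimately show ?thesis by blast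
qed

section \<open>Passage from the unipotent group to the torsor\<close>

lemma image_orbit_act: "(\<lambda>p. act p F) ` orbit G (**) p = orbit G act (act p F)"
  by (auto simp: orbit_def act_act)

lemma act_p_zy_p_x:
  "act (p_zy z y ** p_x x) (tilde \<tau>) = F0 \<tau> (perB \<tau> (cvec x)) (perA \<tau> (cvec y))
     (two_pi_i * z - dotc (perB \<tau> (cvec x)) (lower (cvec y)))"
  by (simp add: p_zy_def p_x_def block_mult_block tilde_def act_F0)

lemma act_p_x: "act (p_x x) (tilde \<tau>) = F0 \<tau> (perB \<tau> (cvec x)) 0 0"
  by (simp add: p_x_def tilde_def act_F0)

lemma Pu_Ints_PuR_UC:
  assumes "p \<in> Pu \<int>" "q \<in> PuR_UC" shows "p ** q \<in> PuR_UC"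
proof -
  have "x \<in> vecs \<int> \<Longrightarrow> x \<in> vecs \<real>" for x :: "complex ^ ('a + 'a)"
    by (auto simp: vecs_Ints_complex vecs_Reals)
  moreover have "x \<in> vecs \<real> \<Longrightarrow> y \<in> vecs \<real> \<Longrightarrow> x + y \<in> vecs \<real>" for x y :: "complex ^ ('a + 'a)"
    by (auto simp: vecs_def)
  ultimately show ?thesis
    using assms unfolding Pu_def PuR_UC_eq by (clarsimp simp: block_mult_block block_eq_iff)
qed

text \<open>Solving the difference for the dual, \<open>g\<close> has the linear lift
  \<open>L - K\<close> and the lattice matrix \<open>F - A\<close>, and
  \<open>dual_lattice_matrix\<close> identifies the latter with
  \<open>- transpose F\<close>.\<close>

lemma dual_sum:
  fixes F A :: "int ^ ('d::finite + 'd) ^ ('d + 'd)"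
  assumes \<tau>: "\<tau> \<in> siegel" and dual: "dual_morphism \<tau> f g" and F: "lattice_matrix \<tau> f F"
    and A: "lattice_matrix \<tau> (\<lambda>b. f b \<otimes>\<^bsub>avA \<tau>\<^esub> inv\<^bsub>avA \<tau>\<^esub> g b) A"
  shows "A = F + transpose F"
proof -
  obtain L where L: "\<And>u. f (clsB \<tau> u) = clsA \<tau> (L *v u)"
    "\<And>n. n \<in> vecs \<int> \<Longrightarrow> L *v perB \<tau> n = perA \<tau> (map_matrix of_int F *v n)"
    using F unfolding lattice_matrix_def by blast
  obtain K where K: "\<And>u. f (clsB \<tau> u) \<otimes>\<^bsub>avA \<tau>\<^esub> inv\<^bsub>avA \<tau>\<^esub> g (clsB \<tau> u) = clsA \<tau> (K *v u)"
    "\<And>n. n \<in> vecs \<int> \<Longrightarrow> K *v perB \<tau> n = perA \<tau> (map_matrix of_int A *v n)"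
    using A unfolding lattice_matrix_def by blast
  have 1: "g (clsB \<tau> u) = clsA \<tau> ((L - K) *v u)" for u
  proof -
    have "g \<in> carrier (avB \<tau>) \<rightarrow> carrier (avA \<tau>)"
      using dual by (auto simp: dual_morphism_def av_morphism_def hom_def)
    then obtain v where v: "g (clsB \<tau> u) = clsA \<tau> v"
      by (auto simp: carrier_avB carrier_avA)
    have "clsA \<tau> (L *v u - v) = clsA \<tau> (K *v u)"
      using K(1) [of u] by (simp add: L(1) v inv_avA mult_avA)
    then obtain y where y: "y \<in> vecs \<int>" "L *v u - v - K *v u = perA \<tau> y" by (auto simp: clsA_eq_iff)
    have "v - (L - K) *v u = perA \<tau> (- y)"
      by (simp add: y(2) [symmetric] matrix_vector_mult_diff_rdistrib)
    then show ?thesis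
      unfolding v clsA_eq_iff using y(1) by (metis imageI vecs_Ints_simps(3))
  qed
  have 2: "(L - K) *v perB \<tau> n = perA \<tau> (map_matrix of_int (F - A) *v n)" if "n \<in> vecs \<int>" for n
  proof -
    have "(map_matrix of_int (F - A) :: complex ^ ('d + 'd) ^ ('d + 'd)) = map_matrix of_int F - map_matrix of_int A"
      by (simp add: map_matrix_def vec_eq_iff)
    then show ?thesis
      by (simp add: matrix_vector_mult_diff_rdistrib L(2) K(2) that)
  qed
  have "F - A = - transpose F"
    by (rule dual_lattice_matrix [OF \<tau> dual L 1 2])
  then show ?thesis by (simp add: algebra_simps)
qed

text \<open>The vector \<open>m\<close>, which is \<open>n\<close> times \<open>x\<close>, is
  integral. The torus coordinate of the section is linear in \<open>x\<close> and the other one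
  quadratic; multiplied by \<open>n\<^sup>2\<close> they become \<open>n\<close> times the image of
  \<open>m\<close> under \<open>N\<close>, an integral vector, and \<open>two_pi_i\<close> times the
  value at \<open>m\<close> of the quadratic form of \<open>M\<close>, an integer.\<close>

lemma (in symmetric_lattice_map) ribet_section_killed:
  assumes "0 < n" and ord: "group.ord (avB \<tau>) (ptB \<tau> x) = n"
  shows "ribet_section \<tau> N (ptB \<tau> x) [^]\<^bsub>ext_group \<tau> (ptB \<tau> x)\<^esub> (n\<^sup>2) = \<one>\<^bsub>ext_group \<tau> (ptB \<tau> x)\<^esub>"
proof -
  let ?u = "perB \<tau> (cvec x)"
  define m where "m = real n *\<^sub>R x"
  have "ptB \<tau> x [^]\<^bsub>avB \<tau>\<^esub> n = \<one>\<^bsub>avB \<tau>\<^esub>"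
    using group.pow_ord_eq_1 [OF comm_group.axioms(2) [OF comm_group_avB], of "ptB \<tau> x" \<tau>]
    by (simp only: ord) (simp add: carrier_avB ptB_def)
  then have "clsB \<tau> (perB \<tau> (cvec m)) = clsB \<tau> 0"
    by (simp add: ptB_def pow_avB one_avB m_def)
  then obtain m' where "m' \<in> vecs \<int>" "perB \<tau> (cvec m) = perB \<tau> (cvec m')"
    by (auto simp: clsB_eq_iff vecs_Ints_complex)
  then have m: "m \<in> vecs \<int>" by (simp only: perB_real_inj [OF siegel])
  define y where "y = real n *\<^sub>R (map_matrix of_int N *v m)"
  have "y = map_matrix of_int N *v (real n *\<^sub>R m)"
    by (simp add: y_def matrix_vector_mult_scaleR)
  moreover have "real n *\<^sub>R m \<in> vecs \<int>" using m by (auto simp: vecs_def)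
  ultimately have y: "cvec y \<in> vecs \<int>" by (simp add: of_int_matrix_Ints)
  have y': "y = (real n)\<^sup>2 *\<^sub>R (map_matrix of_int N *v x)"
    by (simp add: y_def m_def matrix_vector_mult_scaleR power2_eq_square)
  have "m \<bullet> (map_matrix of_int M *v m) \<in> \<int>"
    using dotc_Ints [of "cvec m" "map_matrix of_int M *v cvec m"] m
    by (simp add: of_int_matrix_cvec of_int_matrix_Ints dotc_cvec complex_of_real_Ints_iff)
  moreover have q: "m \<bullet> (map_matrix of_int M *v m) = (real n)\<^sup>2 * (x \<bullet> (map_matrix of_int M *v x))"
    by (simp add: m_def matrix_vector_mult_scaleR power2_eq_square)
  ultimately have "complex_of_real ((real n)\<^sup>2 * (x \<bullet> (map_matrix of_int M *v x))) \<in> \<int>"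
    by (simp only: complex_of_real_Ints_iff)
  then have "exp 0 = exp (two_pi_i * of_real ((real n)\<^sup>2 * (x \<bullet> (map_matrix of_int M *v x))))"
    unfolding exp_eq_iff_period by (intro bexI) simp_all
  then have e: "pt \<tau> ?u 0 (two_pi_i * of_real ((real n)\<^sup>2 * (x \<bullet> (map_matrix of_int M *v x)))) = pt \<tau> ?u 0 0"
    by (simp only: pt_eq_exp_iff [OF siegel])
  have "ribet_section \<tau> N (ptB \<tau> x) [^]\<^bsub>ext_group \<tau> (ptB \<tau> x)\<^esub> (n\<^sup>2) =
     pt \<tau> ?u (0 + perA \<tau> (cvec y))
     (two_pi_i * of_real ((real n)\<^sup>2 * (x \<bullet> (map_matrix of_int M *v x))) - dotc ?u (lower (cvec y)))"
    unfolding ribet_section_ptB unfolding ptB_def pow_ext_group [OF siegel] y'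
    by (simp add: algebra_simps)
  \<comment> \<open>Removing the period \<open>perA \<tau> (cvec y)\<close> cancels the term with
    \<open>lower (cvec y)\<close>, and an integer multiple of \<open>two_pi_i\<close>
    remains.\<close>
  also have "\<dots> = pt \<tau> ?u 0 0"
    unfolding pt_shift_v [OF y] by (simp add: e [simplified] del: mult_eq_0_iff)
  finally show ?thesis by (simp add: ptB_def one_ext_group [OF siegel])
qed

theorem proposition5p3:
  fixes \<tau>\<^sub>0 \<tau> :: "complex ^ 'd::finite ^ 'd"
    and f f_dual :: "(complex ^ 'd) set \<Rightarrow> (complex ^ 'd) set"
    and f\<^sub>Z \<alpha>\<^sub>Z :: "int ^ ('d + 'd) ^ ('d + 'd)"
  assumes "\<tau>\<^sub>0 \<in> siegel"
    and "av_morphism \<tau>\<^sub>0 f"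
    and "dual_morphism \<tau>\<^sub>0 f f_dual"
    and "lattice_matrix \<tau>\<^sub>0 f f\<^sub>Z"
    and "lattice_matrix \<tau>\<^sub>0 (\<lambda>b. f b \<otimes>\<^bsub>avA \<tau>\<^sub>0\<^esub> inv\<^bsub>avA \<tau>\<^sub>0\<^esub> f_dual b) \<alpha>\<^sub>Z"
    and "\<tau> \<in> H_alpha \<alpha>\<^sub>Z \<tau>\<^sub>0"
  shows
    "bij_betw (\<lambda>p. act p (tilde \<tau>)) PuR_UC (D_alpha_fibre \<alpha>\<^sub>Z \<tau>\<^sub>0 \<tau>) \<and>
     orbits (mat_monoid (Pu \<int>)) (D_alpha_fibre \<alpha>\<^sub>Z \<tau>\<^sub>0 \<tau>) act = poincare \<tau> \<and>
     bij_betw (\<lambda>C. (\<lambda>p. act p (tilde \<tau>)) ` C)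
       (orbits (mat_monoid (Pu \<int>)) PuR_UC (**)) (poincare \<tau>) \<and>
     (\<lambda>C. (\<lambda>p. act p (tilde \<tau>)) ` C) `
         {orbit (mat_monoid (Pu \<int>)) (**) (p_x x) | x. True}
       = unit_section \<tau> ` carrier (avB \<tau>) \<and>
     (\<forall>x. \<exists>\<Phi>.
        lie_iso std_cls std_group
          (\<lambda>(v, w). pt \<tau> (perB \<tau> (cvec x)) v w) (ext_group \<tau> (ptB \<tau> x)) \<Phi> \<and>
        (\<forall>z y. \<Phi> (std_cls (two_pi_i * z, y)) =
           orbit (mat_monoid (Pu \<int>)) act (act (p_zy z y ** p_x x) (tilde \<tau>))) \<and>
        ribet_section \<tau> \<alpha>\<^sub>Z (ptB \<tau> x) =
          \<Phi> (std_cls (two_pi_i * complex_of_real (x \<bullet> (map_matrix of_int f\<^sub>Z *v x)),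
                      map_matrix of_int \<alpha>\<^sub>Z *v x))) \<and>
     (\<forall>x n. 0 < n \<and> group.ord (avB \<tau>) (ptB \<tau> x) = n \<longrightarrow>
        ribet_section \<tau> \<alpha>\<^sub>Z (ptB \<tau> x) [^]\<^bsub>ext_group \<tau> (ptB \<tau> x)\<^esub> (n\<^sup>2) =
          \<one>\<^bsub>ext_group \<tau> (ptB \<tau> x)\<^esub>)"
proof (intro conjI allI impI)
  have \<tau>: "\<tau> \<in> siegel" using assms(6) by (simp add: H_alpha_def)
  obtain L where "\<And>n. n \<in> vecs \<int> \<Longrightarrow> L *v perB \<tau>\<^sub>0 n = perA \<tau>\<^sub>0 (map_matrix of_int \<alpha>\<^sub>Z *v n)"
    using assms(5) unfolding lattice_matrix_def by blast
  \<comment> \<open>\<open>tangent_map_period\<close> provides the morphism at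
    \<open>\<tau>\<close>, and \<open>dual_sum\<close>, applied at \<open>\<tau>\<^sub>0\<close>,
    the decomposition of \<open>\<alpha>\<^sub>Z\<close>.\<close>
  then interpret symmetric_lattice_map \<tau> \<alpha>\<^sub>Z f\<^sub>Z
    using \<tau> tangent_map_period [OF _ assms(6), of L] dual_sum [OF assms(1,3-5)]
    by unfold_locales auto
  have fibre: "D_alpha_fibre \<alpha>\<^sub>Z \<tau>\<^sub>0 \<tau> = D_fibre \<tau>" by (rule D_alpha_fibre_eq [OF assms(6)])
  show bij: "bij_betw (\<lambda>p. act p (tilde \<tau>)) PuR_UC (D_alpha_fibre \<alpha>\<^sub>Z \<tau>\<^sub>0 \<tau>)"
    unfolding fibre by (rule bij_PuR_UC_D_fibre [OF \<tau>])
  show "orbits (mat_monoid (Pu \<int>)) (D_alpha_fibre \<alpha>\<^sub>Z \<tau>\<^sub>0 \<tau>) act = poincare \<tau>"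
    by (simp add: fibre poincare_def)
  show "bij_betw (\<lambda>C. (\<lambda>p. act p (tilde \<tau>)) ` C) (orbits (mat_monoid (Pu \<int>)) PuR_UC (**)) (poincare \<tau>)"
  proof (rule bij_betw_imageI)
    \<comment> \<open>Orbits are subsets of \<open>PuR_UC\<close>, on which the map to the fibre is
      injective, so taking images of orbits is injective as well.\<close>
    have "orbits (mat_monoid (Pu \<int>)) PuR_UC (**) \<subseteq> Pow PuR_UC"
      by (auto simp: orbits_def orbit_def mat_monoid_def Pu_Ints_PuR_UC)
    then show "inj_on (\<lambda>C. (\<lambda>p. act p (tilde \<tau>)) ` C) (orbits (mat_monoid (Pu \<int>)) PuR_UC (**))"
      using inj_on_image_Pow [OF bij_betw_imp_inj_on [OF bij]] inj_on_subset by blast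
    have "D_fibre \<tau> = (\<lambda>p. act p (tilde \<tau>)) ` PuR_UC"
      using bij_betw_imp_surj_on [OF bij] fibre by simp
    then show "(\<lambda>C. (\<lambda>p. act p (tilde \<tau>)) ` C) ` orbits (mat_monoid (Pu \<int>)) PuR_UC (**) = poincare \<tau>"
      unfolding poincare_def orbits_def by (simp only: Setcompr_eq_image image_image image_orbit_act)
  qed
  have unit: "unit_section \<tau> (ptB \<tau> x) = orbit (mat_monoid (Pu \<int>)) act (act (p_x x) (tilde \<tau>))" for x
    by (simp add: unit_section_def ptB_def one_ext_group [OF \<tau>] act_p_x pt_def)
  \<comment> \<open>Every point of \<open>B\<close> has real coordinates, so the classes of the
    \<open>p_x\<close> give the unit over all of \<open>B\<close>.\<close>
  have "carrier (avB \<tau>) = range (ptB \<tau>)"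
    using perB_real_ex [OF \<tau>] by (auto simp: carrier_avB ptB_def image_iff) metis
  then show "(\<lambda>C. (\<lambda>p. act p (tilde \<tau>)) ` C) ` {orbit (mat_monoid (Pu \<int>)) (**) (p_x x) | x. True}
      = unit_section \<tau> ` carrier (avB \<tau>)"
    by (simp add: full_SetCompr_eq image_image image_orbit_act unit)
  show "\<exists>\<Phi>. lie_iso std_cls std_group
          (\<lambda>(v, w). pt \<tau> (perB \<tau> (cvec x)) v w) (ext_group \<tau> (ptB \<tau> x)) \<Phi> \<and>
        (\<forall>z y. \<Phi> (std_cls (two_pi_i * z, y)) =
           orbit (mat_monoid (Pu \<int>)) act (act (p_zy z y ** p_x x) (tilde \<tau>))) \<and>
        ribet_section \<tau> \<alpha>\<^sub>Z (ptB \<tau> x) =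
          \<Phi> (std_cls (two_pi_i * complex_of_real (x \<bullet> (map_matrix of_int f\<^sub>Z *v x)),
                      map_matrix of_int \<alpha>\<^sub>Z *v x))" for x
    \<comment> \<open>The formula for \<open>\<Phi>\<close> becomes \<open>act_p_zy_p_x\<close> for
      \<open>s = two_pi_i * z\<close>, and \<open>ribet_section_ptB\<close> for the coordinates
      claimed for the section.\<close>
    using ext_group_lie_iso [OF \<tau>, of "perB \<tau> (cvec x)"]
    by (auto simp: ribet_section_ptB act_p_zy_p_x simp flip: ptB_def pt_def)
  show "ribet_section \<tau> \<alpha>\<^sub>Z (ptB \<tau> x) [^]\<^bsub>ext_group \<tau> (ptB \<tau> x)\<^esub> (n\<^sup>2) = \<one>\<^bsub>ext_group \<tau> (ptB \<tau> x)\<^esub>"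
    if "0 < n \<and> group.ord (avB \<tau>) (ptB \<tau> x) = n" for x n
    using that ribet_section_killed by blast
qed

end
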